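(* Let $n\in\mathbb{N}$ and let $\mathfrak{N}$ be the class of non-degenerate ReLU networks with real weights and biases, with $n$ input nodes, realizing functions $f:[0,1]^n\to[0,1]$. The set of axioms $\mathcal{RMV}$ completely identifies $\mathfrak{N}$ over $[0,1]^n$, that is: for all $\mathcal{N}_1,\mathcal{N}_2\in\mathfrak{N}$, if $\langle\mathcal{N}_1\rangle(x)=\langle\mathcal{N}_2\rangle(x)$ for all $x\in[0,1]^n$, then $\mathcal{N}_1\overset{\mathcal{RMV}}{\sim}\mathcal{N}_2$, i.e. the Riesz Łukasiewicz formula $[\mathrm{ext}(\mathcal{N}_2)]$ is derivable from $[\mathrm{ext}(\mathcal{N}_1)]$ in finitely many steps by application of the axioms $\mathcal{RMV}$.
   Context: **Layered graphs and networks.** A layered graph of depth $L\ge1$ and architecture $(d_0,\dots,d_L)$, $d_L=1$, $d_j\ge 1$, has nodes partitioned into levels $V^{(j)}=\{v^{(j)}_1,\dots,v^{(j)}_{d_j}\}$, $j=0,\dots,L$, $V^{(L)}=\{v_{\rm out}\}$, with edges exactly all pairs (node of level $j-1$, node of level $j$), $j=1,\dots,L$. A neural network is a layered graph with a weight $w_{v,u}\in\mathbb{R}$ on each edge $(u,v)$ (possibly zero), a bias $b_v$ at each non-input node, and activation functions. $V^{(0)}$ are input nodes; nodes at levels $1,\dots,L-1$ are hidden. In a ReLU network ($\rho$-network) all hidden nodes have activation $\rho(t)=\max\{t,0\}$ and the output node has none; in a $\sigma$-network all non-input nodes (output included) have activation $\sigma(t)=\max\{\min\{t,1\},0\}$.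 The local map $\langle v\rangle$ of a node at level $j\ge 1$ is $x\mapsto\psi_v(\sum_{i'}w_{v,v^{(j-1)}_{i'}}x_{i'}+b_v)$, $x\in\mathbb{R}^{d_{j-1}}$ ($\psi_v$ the activation, or identity if none), and $\langle v_i^{(0)}\rangle(x)=x_i$. The global map $\langle\!\langle v\rangle\!\rangle:\mathbb{R}^{d_0}\to\mathbb{R}$ is obtained by composing local maps from the inputs on, and $\langle\mathcal{N}\rangle=\langle\!\langle v_{\rm out}\rangle\!\rangle$. "Realizing a function $[0,1]^n\to[0,1]$" means $d_0=n$ and $\langle\mathcal N\rangle([0,1]^n)\subseteq[0,1]$. **Non-degenerate.** A ReLU network is non-degenerate (on $[0,1]^{d_0}$) if: every hidden node $v$ satisfies $\langle\!\langle v\rangle\!\rangle(x)>0$ for some $x\in[0,1]^{d_0}$; every hidden node satisfies $\langle\!\langle v\rangle\!\rangle(x)=0$ for some $x\in[0,1]^{d_0}$; no two nodes at the same level have the same local map; every hidden node has at least one nonzero outgoing weight. **Formulae.** A Riesz Łukasiewicz ($\mathcal{RL}$) formula is a finite string built from propositional variables $x_1,x_2,\dots$, constants $0,1$, binary connectives $\oplus,\odot$, and unary connectives $\lnot$ and $\Delta_r$ ($r\in[0,1]$). Its truth function is obtained by evaluating in $\mathbb{I}_R$, i.e. on $[0,1]$ with $x\oplus y=\min\{1,x+y\}$, $x\odot y=\max\{0,x+y-1\}$, $\lnot x=1-x$, $\Delta_rx=rx$. **Axioms.** $\mathcal{MV}$ consists of: $x\oplus y=y\oplus x$; $x\odot y=y\odot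 x$; $x\oplus(y\oplus z)=(x\oplus y)\oplus z$; $x\odot(y\odot z)=(x\odot y)\odot z$; $x\oplus\lnot x=1$; $x\odot\lnot x=0$; $x\oplus1=1$; $x\odot0=0$; $x\oplus0=x$; $x\odot1=x$; $\lnot(x\oplus y)=\lnot x\odot\lnot y$; $\lnot(x\odot y)=\lnot x\oplus\lnot y$; $x=\lnot(\lnot x)$; $\lnot0=1$; $(x\odot\lnot y)\oplus y=(y\odot\lnot x)\oplus x$; $(x\oplus\lnot y)\odot y=(y\oplus\lnot x)\odot x$. $\mathcal{RMV}$ is $\mathcal{MV}$ together with, for all $r,q\in[0,1]$: $\Delta_r(x\odot\lnot y)=(\Delta_rx)\odot\lnot(\Delta_ry)$; $\Delta_{\max\{0,r-q\}}x=(\Delta_rx)\odot\lnot(\Delta_qx)$; $\Delta_r(\Delta_qx)=\Delta_{rq}x$; $\Delta_1x=x$. **Derivation.** An equation $\gamma=\gamma'$ instantiates an axiom $\epsilon=\epsilon'$ if, for some substitution of formulae for variables applied to both sides, it becomes $\gamma=\gamma'$ or $\gamma'=\gamma$. A derivation step replaces one occurrence of a subformula $\gamma$ by $\gamma'$ where $\gamma=\gamma'$ instantiates an axiom. $\tau\overset{\mathcal{RMV}}{\sim}\tau'$ means $\tau'$ is reached from $\tau$ by finitely many (possibly zero) steps using axioms of $\mathcal{RMV}$. **Substitution graphs.** A substitution graph is a layered graph with a formula $[v]$ at each node: $[v_i^{(0)}]=x_i$, and a node at level $j\ge1$ carries a formula in the variables $x_1,\dots,x_{d_{j-1}}$, $x_{i'}$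 referring to the parent $v^{(j-1)}_{i'}$. The represented formula $[\mathcal{G}]$ is obtained from $[v_{\rm out}]$ by simultaneously replacing each $x_{i'}$ by $[v_{i'}^{(L-1)}]$, then in the result each $x_{i'}$ by $[v_{i'}^{(L-2)}]$, and so on down to level $0$. **Extraction (real version).** For a ReLU network $\mathcal{N}$ with real weights and biases and $[0,1]$-valued on $[0,1]^{d_0}$, $\mathrm{ext}(\mathcal{N})$ is defined as follows. *Step I.* For $j=1,\dots,L-1$ in this order, for each node $v$ of level $j$ compute $\mathcal{L}_v=b_v+\sum_u\max\{w_{v,u},0\}$ over its (already converted) parents $u$. If $\mathcal{L}_v\le1$, replace its activation by $\sigma$; if $\mathcal{L}_v>1$, replace $v$ by $\lceil\mathcal{L}_v\rceil$ $\sigma$-nodes with the same incoming and outgoing weights and biases $b_v,b_v-1,\dots,b_v-\lceil\mathcal{L}_v\rceil+1$ (nodes of each new level enumerated in a fixed order). Finally apply $\sigma$ at the output node. *Step II.* Each input node gets $x_i$; each non-input node with local map $\sigma(f)$ gets $\mathtt{EXTR}(\sigma(f))$, where for $f=m_1x_1+\dots+m_nx_n+b$ with real coefficients, with min $\ell$ and max $\mathcal{L}$ over $[0,1]^n$: return $1$ if $\ell\ge1$; return $0$ if $\mathcal{L}\le0$; otherwise, if all $m_i=0$ (so $b\in(0,1)$) return $\Delta_b1$; otherwise let $k$ be the smallest index with $m_k\ne0$; if $m_k\ge1$ return $(\mathtt{EXTR}(\sigma(f-x_k))\oplus x_k)\odot\mathtt{EXTR}(\sigma(f-x_k+1))$;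 if $0<m_k<1$ return $(\mathtt{EXTR}(\sigma(f-m_kx_k))\oplus\Delta_{m_k}x_k)\odot\mathtt{EXTR}(\sigma(f-m_kx_k+1))$; if $m_k<0$ return $\lnot\,\mathtt{EXTR}(\sigma(1-f))$; occurrences $0\oplus\tau$ and $\tau\odot1$ produced by the recursion are simplified to $\tau$. $\mathrm{ext}(\mathcal N)$ is the layered graph of the $\sigma$-network from Step I with the node formulae of Step II. **Network derivation.** $\mathcal{N}_1\overset{\mathcal{RMV}}{\sim}\mathcal{N}_2$ means $[\mathrm{ext}(\mathcal{N}_1)]\overset{\mathcal{RMV}}{\sim}[\mathrm{ext}(\mathcal{N}_2)]$. *)

theory Defs
  imports Complex_Main
begin

section \<open>Layered networks\<close>

text \<open>Points of \<open>\<real>\<^sup>n\<close> are real lists of length \<open>n\<close>, since the dimension varies from level to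
  level.  All node and variable indices start at 0, so the node \<open>v\<^sub>i\<close> and the variable \<open>x\<^sub>i\<close>
  of the usual notation have index \<open>i - 1\<close>.\<close>

definition cube :: "nat \<Rightarrow> real list set" where
  "cube n = {x. length x = n \<and> (\<forall>t \<in> set x. 0 \<le> t \<and> t \<le> 1)}"

text \<open>The \<open>i\<close>-th weight of a node is the weight of the edge from the \<open>i\<close>-th node of the previous
  level; possibly zero weights make the graph complete between consecutive levels.\<close>

datatype neuron = Neuron (weights: "real list") (bias: real)

text \<open>\<open>levels N\<close> lists the levels \<open>1, \<dots>, L\<close>; the input level is given by the number of
  its nodes only.\<close>

datatype network = Network (inputs: nat) (levels: "neuron list list")

definition depth :: "network \<Rightarrow> nat" where
  "depth N = length (levels N)"

definition width :: "network \<Rightarrow> nat \<Rightarrow> nat" where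
  "width N j = (if j = 0 then inputs N else length (levels N ! (j - 1)))"

definition node :: "network \<Rightarrow> nat \<Rightarrow> nat \<Rightarrow> neuron" where
  "node N j i = levels N ! (j - 1) ! i"

definition wf_network :: "network \<Rightarrow> bool" where
  "wf_network N \<longleftrightarrow>
     1 \<le> depth N \<and>
     width N (depth N) = 1 \<and>
     (\<forall>j \<le> depth N. 1 \<le> width N j) \<and>
     (\<forall>j \<in> {1..depth N}. \<forall>i < width N j. length (weights (node N j i)) = width N (j - 1))"

definition affine :: "real list \<Rightarrow> real \<Rightarrow> real list \<Rightarrow> real" where
  "affine m b x = (\<Sum>i<length m. m ! i * x ! i) + b"

definition relu :: "real \<Rightarrow> real" where
  "relu t = max t 0"

text \<open>Local and global maps of a ReLU network: hidden nodes carry the activation \<open>relu\<close>, the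
  output node carries none.  \<open>global_maps N j x\<close> collects the values at \<open>x\<close> of the global
  maps of all nodes of level \<open>j\<close>.\<close>

definition local_map :: "network \<Rightarrow> nat \<Rightarrow> nat \<Rightarrow> real list \<Rightarrow> real" where
  "local_map N j i x =
     (if j = 0 then x ! i
      else (if j < depth N then relu else id)
             (affine (weights (node N j i)) (bias (node N j i)) x))"

primrec global_maps :: "network \<Rightarrow> nat \<Rightarrow> real list \<Rightarrow> real list" where
  "global_maps N 0 x = map (\<lambda>i. local_map N 0 i x) [0..<width N 0]"
| "global_maps N (Suc j) x =
     map (\<lambda>i. local_map N (Suc j) i (global_maps N j x)) [0..<width N (Suc j)]"

definition global_map :: "network \<Rightarrow> nat \<Rightarrow> nat \<Rightarrow> real list \<Rightarrow> real" where
  "global_map N j i x = global_maps N j x ! i"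

definition realization :: "network \<Rightarrow> real list \<Rightarrow> real" where
  "realization N = global_map N (depth N) 0"

text \<open>For \<open>j = 0\<close> the truncated \<open>j - 1\<close> is 0, which is the right domain dimension for the local
  maps of the input nodes.\<close>

definition nondegenerate :: "network \<Rightarrow> bool" where
  "nondegenerate N \<longleftrightarrow>
     (\<forall>j \<in> {1..<depth N}. \<forall>i < width N j. \<exists>x \<in> cube (inputs N). global_map N j i x > 0) \<and>
     (\<forall>j \<in> {1..<depth N}. \<forall>i < width N j. \<exists>x \<in> cube (inputs N). global_map N j i x = 0) \<and>
     (\<forall>j \<le> depth N. \<forall>i < width N j. \<forall>i' < width N j. i \<noteq> i' \<longrightarrow>
        \<not> (\<forall>x. length x = width N (j - 1) \<longrightarrow> local_map N j i x = local_map N j i' x)) \<and>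
     (\<forall>j \<in> {1..<depth N}. \<forall>i < width N j. \<exists>u < width N (j + 1).
        weights (node N (j + 1) u) ! i \<noteq> 0)"

definition nondegenerate_networks :: "nat \<Rightarrow> network set" where
  "nondegenerate_networks n =
     {N. wf_network N \<and> inputs N = n \<and> nondegenerate N \<and> realization N ` cube n \<subseteq> {0..1}}"


section \<open>Riesz Lukasiewicz formulae and derivations\<close>

typedef unit_real = "{0..1::real}"
  morphisms of_unit_real to_unit_real
  by (rule exI[of _ 0]) simp

datatype formula =
    Var nat
  | Zero
  | One
  | Oplus formula formula  (infixl "\<oplus>" 65)
  | Odot formula formula  (infixl "\<odot>" 70)
  | Neg formula
  | Delta unit_real formula

text \<open>Only meaningful for \<open>r \<in> {0..1}\<close>; outside, \<open>to_unit_real r\<close> is some unspecified element.\<close>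

abbreviation \<Delta> :: "real \<Rightarrow> formula \<Rightarrow> formula" where
  "\<Delta> r \<equiv> Delta (to_unit_real r)"

primrec subst :: "(nat \<Rightarrow> formula) \<Rightarrow> formula \<Rightarrow> formula" where
  "subst s (Var i) = s i"
| "subst s Zero = Zero"
| "subst s One = One"
| "subst s (\<phi> \<oplus> \<psi>) = subst s \<phi> \<oplus> subst s \<psi>"
| "subst s (\<phi> \<odot> \<psi>) = subst s \<phi> \<odot> subst s \<psi>"
| "subst s (Neg \<phi>) = Neg (subst s \<phi>)"
| "subst s (Delta r \<phi>) = Delta r (subst s \<phi>)"

text \<open>A pair \<open>(\<epsilon>, \<epsilon>')\<close> stands for the equation between its components.\<close>

definition MV :: "(formula \<times> formula) set" where
  "MV = (let x = Var 0; y = Var 1; z = Var 2 in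
    {(x \<oplus> y, y \<oplus> x),
     (x \<odot> y, y \<odot> x),
     (x \<oplus> (y \<oplus> z), (x \<oplus> y) \<oplus> z),
     (x \<odot> (y \<odot> z), (x \<odot> y) \<odot> z),
     (x \<oplus> Neg x, One),
     (x \<odot> Neg x, Zero),
     (x \<oplus> One, One),
     (x \<odot> Zero, Zero),
     (x \<oplus> Zero, x),
     (x \<odot> One, x),
     (Neg (x \<oplus> y), Neg x \<odot> Neg y),
     (Neg (x \<odot> y), Neg x \<oplus> Neg y),
     (x, Neg (Neg x)),
     (Neg Zero, One),
     ((x \<odot> Neg y) \<oplus> y, (y \<odot> Neg x) \<oplus> x),
     ((x \<oplus> Neg y) \<odot> y, (y \<oplus> Neg x) \<odot> x)})"

definition RMV :: "(formula \<times> formula) set" where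
  "RMV = (let x = Var 0; y = Var 1 in
     MV
     \<union> {(\<Delta> r (x \<odot> Neg y), \<Delta> r x \<odot> Neg (\<Delta> r y)) | r. r \<in> {0..1}}
     \<union> {(\<Delta> (max 0 (r - q)) x, \<Delta> r x \<odot> Neg (\<Delta> q x)) | r q. r \<in> {0..1} \<and> q \<in> {0..1}}
     \<union> {(\<Delta> r (\<Delta> q x), \<Delta> (r * q) x) | r q. r \<in> {0..1} \<and> q \<in> {0..1}}
     \<union> {(\<Delta> 1 x, x)})"

definition instantiates :: "(formula \<times> formula) set \<Rightarrow> formula \<Rightarrow> formula \<Rightarrow> bool" where
  "instantiates E \<gamma> \<gamma>' \<longleftrightarrow>
     (\<exists>(\<epsilon>, \<epsilon>') \<in> E. \<exists>s. (subst s \<epsilon> = \<gamma> \<and> subst s \<epsilon>' = \<gamma>') \<or> (subst s \<epsilon> = \<gamma>' \<and> subst s \<epsilon>' = \<gamma>))"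

inductive step :: "(formula \<times> formula) set \<Rightarrow> formula \<Rightarrow> formula \<Rightarrow> bool" for E where
  "instantiates E \<gamma> \<gamma>' \<Longrightarrow> step E \<gamma> \<gamma>'"
| "step E \<phi> \<phi>' \<Longrightarrow> step E (\<phi> \<oplus> \<psi>) (\<phi>' \<oplus> \<psi>)"
| "step E \<psi> \<psi>' \<Longrightarrow> step E (\<phi> \<oplus> \<psi>) (\<phi> \<oplus> \<psi>')"
| "step E \<phi> \<phi>' \<Longrightarrow> step E (\<phi> \<odot> \<psi>) (\<phi>' \<odot> \<psi>)"
| "step E \<psi> \<psi>' \<Longrightarrow> step E (\<phi> \<odot> \<psi>) (\<phi> \<odot> \<psi>')"
| "step E \<phi> \<phi>' \<Longrightarrow> step E (Neg \<phi>) (Neg \<phi>')"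
| "step E \<phi> \<phi>' \<Longrightarrow> step E (Delta r \<phi>) (Delta r \<phi>')"

definition derivable :: "(formula \<times> formula) set \<Rightarrow> formula \<Rightarrow> formula \<Rightarrow> bool" where
  "derivable E = (step E)\<^sup>*\<^sup>*"


section \<open>Substitution graphs\<close>

text \<open>The formulae of the levels \<open>0, \<dots>, L\<close>, each level in the order of its nodes.\<close>

type_synonym subst_graph = "formula list list"

definition subst_level :: "formula list \<Rightarrow> formula \<Rightarrow> formula" where
  "subst_level lev = subst (\<lambda>i. if i < length lev then lev ! i else Var i)"

text \<open>\<open>foldr\<close> substitutes level \<open>L - 1\<close> first and level 0 last.\<close>

definition represented :: "subst_graph \<Rightarrow> formula" where
  "represented G = foldr subst_level (butlast G) (hd (last G))"


section \<open>Extraction\<close>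

subsection \<open>From ReLU to clipped ReLU\<close>

definition max_preact :: "neuron \<Rightarrow> real" where
  "max_preact v = bias v + (\<Sum>w \<leftarrow> weights v. max w 0)"

definition copies :: "neuron \<Rightarrow> nat" where
  "copies v = (if max_preact v \<le> 1 then 1 else nat \<lceil>max_preact v\<rceil>)"

definition split_node :: "neuron \<Rightarrow> neuron list" where
  "split_node v = map (\<lambda>k. Neuron (weights v) (bias v - real k)) [0..<copies v]"

text \<open>If the parent with index \<open>i\<close> was replaced by \<open>cs ! i\<close> nodes, its outgoing weight is
  repeated for each of them.\<close>

definition rewire :: "nat list \<Rightarrow> neuron \<Rightarrow> neuron" where
  "rewire cs v = Neuron (concat (map2 replicate cs (weights v))) (bias v)"

text \<open>\<open>cs\<close> records into how many nodes each node of the preceding level was split.  The last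
  level, the output node, is not split.\<close>

fun convert :: "nat list \<Rightarrow> neuron list list \<Rightarrow> neuron list list" where
  "convert cs [] = []"
| "convert cs [out] = [map (rewire cs) out]"
| "convert cs (lev # lev' # levs) =
     (let vs = map (rewire cs) lev
      in concat (map split_node vs) # convert (map copies vs) (lev' # levs))"

text \<open>The result is to be read as a network all of whose non-input nodes have the activation
  \<open>\<lambda>t. max (min t 1) 0\<close>.\<close>

definition to_sigma :: "network \<Rightarrow> network" where
  "to_sigma N = Network (inputs N) (convert (replicate (inputs N) 1) (levels N))"

subsection \<open>From clipped affine functions to formulae\<close>

definition affine_min :: "real list \<Rightarrow> real \<Rightarrow> real" where
  "affine_min m b = Inf (affine m b ` cube (length m))"

definition affine_max :: "real list \<Rightarrow> real \<Rightarrow> real" where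
  "affine_max m b = Sup (affine m b ` cube (length m))"

text \<open>The infimum and supremum are attained; closed forms.\<close>

lemma affine_min_attained:
  "affine_min m b \<in> affine m b ` cube (length m)"
  "x \<in> cube (length m) \<Longrightarrow> affine_min m b \<le> affine m b x"
  "affine_min m b = b + (\<Sum>i<length m. min (m ! i) 0)"
proof -
  let ?c = "b + (\<Sum>i<length m. min (m ! i) 0)"
  have lower: "?c \<le> affine m b x" if "x \<in> cube (length m)" for x
  proof -
    have "min (m ! i) 0 \<le> m ! i * x ! i" if "i < length m" for i
    proof -
      have "0 \<le> x ! i" "x ! i \<le> 1"
        using that \<open>x \<in> cube (length m)\<close> by (auto simp: cube_def)
      then show ?thesis
        by (cases "m ! i \<ge> 0") (auto simp: min_def intro: mult_nonneg_nonneg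
            mult_left_mono_neg[of "x ! i" 1 "m ! i", simplified])
    qed
    then show ?thesis
      unfolding affine_def by (auto intro!: sum_mono)
  qed
  define y where "y = map (\<lambda>w. if w < 0 then 1 else (0::real)) m"
  have y: "y \<in> cube (length m)"
    by (auto simp: y_def cube_def)
  have "affine m b y = ?c"
    by (auto simp: affine_def y_def min_def intro!: sum.cong)
  then have att: "?c \<in> affine m b ` cube (length m)"
    using y by force
  have eq: "affine_min m b = ?c"
    unfolding affine_min_def
    by (rule cInf_eq_minimum[OF att]) (auto simp: lower)
  show "affine_min m b = ?c"
    by (rule eq)
  show "affine_min m b \<in> affine m b ` cube (length m)"
    using att eq by simp
  show "x \<in> cube (length m) \<Longrightarrow> affine_min m b \<le> affine m b x"
    using lower eq by simp
qed

lemma affine_max_attained: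
  "affine_max m b \<in> affine m b ` cube (length m)"
  "x \<in> cube (length m) \<Longrightarrow> affine m b x \<le> affine_max m b"
  "affine_max m b = b + (\<Sum>i<length m. max (m ! i) 0)"
proof -
  let ?c = "b + (\<Sum>i<length m. max (m ! i) 0)"
  have upper: "affine m b x \<le> ?c" if "x \<in> cube (length m)" for x
  proof -
    have "m ! i * x ! i \<le> max (m ! i) 0" if "i < length m" for i
    proof -
      have "0 \<le> x ! i" "x ! i \<le> 1"
        using that \<open>x \<in> cube (length m)\<close> by (auto simp: cube_def)
      then show ?thesis
        by (cases "m ! i \<ge> 0") (auto simp: max_def mult_left_le mult_nonpos_nonneg)
    qed
    then show ?thesis
      unfolding affine_def by (auto intro!: sum_mono)
  qed
  define y where "y = map (\<lambda>w. if w > 0 then 1 else (0::real)) m"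
  have y: "y \<in> cube (length m)"
    by (auto simp: y_def cube_def)
  have "affine m b y = ?c"
    by (auto simp: affine_def y_def max_def intro!: sum.cong)
  then have att: "?c \<in> affine m b ` cube (length m)"
    using y by force
  have eq: "affine_max m b = ?c"
    unfolding affine_max_def
    by (rule cSup_eq_maximum[OF att]) (auto simp: upper)
  show "affine_max m b = ?c"
    by (rule eq)
  show "affine_max m b \<in> affine m b ` cube (length m)"
    using att eq by simp
  show "x \<in> cube (length m) \<Longrightarrow> affine m b x \<le> affine_max m b"
    using upper eq by simp
qed

text \<open>The simplifications of \<open>0 \<oplus> \<tau>\<close> and \<open>\<tau> \<odot> 1\<close>.\<close>

definition oplus_simp :: "formula \<Rightarrow> formula \<Rightarrow> formula" where
  "oplus_simp \<phi> \<psi> = (if \<phi> = Zero then \<psi> else \<phi> \<oplus> \<psi>)"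

definition odot_simp :: "formula \<Rightarrow> formula \<Rightarrow> formula" where
  "odot_simp \<phi> \<psi> = (if \<psi> = One then \<phi> else \<phi> \<odot> \<psi>)"

definition first_nonzero :: "real list \<Rightarrow> nat" where
  "first_nonzero m = (LEAST i. i < length m \<and> m ! i \<noteq> 0)"

text \<open>\<open>extr m b\<close> is the formula extracted from the clipped affine function with coefficients
  \<open>m\<close> and constant term \<open>b\<close>.\<close>

function extr :: "real list \<Rightarrow> real \<Rightarrow> formula" where
  "extr m b =
     (if affine_min m b \<ge> 1 then One
      else if affine_max m b \<le> 0 then Zero
      else if \<forall>i < length m. m ! i = 0 then \<Delta> b One
      else let k = first_nonzero m in
        if m ! k \<ge> 1 then
          odot_simp (oplus_simp (extr (m[k := m ! k - 1]) b) (Var k))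
                    (extr (m[k := m ! k - 1]) (b + 1))
        else if m ! k > 0 then
          odot_simp (oplus_simp (extr (m[k := 0]) b) (\<Delta> (m ! k) (Var k)))
                    (extr (m[k := 0]) (b + 1))
        else Neg (extr (map uminus m) (1 - b)))"
  by pat_completeness auto

lemma first_nonzero:
  assumes "\<not> (\<forall>i < length m. m ! i = 0)"
  shows "first_nonzero m < length m" "m ! first_nonzero m \<noteq> 0"
  using assms LeastI_ex[of "\<lambda>i. i < length m \<and> m ! i \<noteq> 0"]
  unfolding first_nonzero_def by auto

lemma first_nonzero_uminus: "first_nonzero (map uminus m) = first_nonzero m"
  unfolding first_nonzero_def by (rule arg_cong[of _ _ Least]) auto

text \<open>Each subtraction lowers the total of the rounded-up absolute values of the coefficients;
  the negation keeps it and makes the leading coefficient positive.\<close>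

definition coeff_size :: "real list \<Rightarrow> nat" where
  "coeff_size m = (\<Sum>w \<leftarrow> m. nat \<lceil>\<bar>w\<bar>\<rceil>)"

lemma coeff_size_update:
  assumes "k < length m" "nat \<lceil>\<bar>w\<bar>\<rceil> < nat \<lceil>\<bar>m ! k\<bar>\<rceil>"
  shows "coeff_size (m[k := w]) < coeff_size m"
  using assms
proof (induction m arbitrary: k)
  case (Cons a m)
  then show ?case by (cases k) (auto simp: coeff_size_def)
qed simp

lemma coeff_size_uminus: "coeff_size (map uminus m) = coeff_size m"
  by (simp add: coeff_size_def o_def)

termination extr
proof (relation "measures [\<lambda>(m, b). coeff_size m,
    \<lambda>(m, b). if m ! first_nonzero m < 0 then 1 else 0]", goal_cases)
  case 1
  show ?case by simp
next
  case (2 m b k)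
  have "k < length m" using first_nonzero 2 by simp
  moreover have "nat \<lceil>\<bar>m ! k - 1\<bar>\<rceil> < nat \<lceil>\<bar>m ! k\<bar>\<rceil>" using 2 by simp
  ultimately show ?case using coeff_size_update by simp
next
  case (3 m b k)
  have "k < length m" using first_nonzero 3 by simp
  moreover have "nat \<lceil>\<bar>m ! k - 1\<bar>\<rceil> < nat \<lceil>\<bar>m ! k\<bar>\<rceil>" using 3 by simp
  ultimately show ?case using coeff_size_update by simp
next
  case (4 m b k)
  have "k < length m" using first_nonzero 4 by simp
  then show ?case using coeff_size_update[of k m 0] 4 by simp
next
  case (5 m b k)
  have "k < length m" using first_nonzero 5 by simp
  then show ?case using coeff_size_update[of k m 0] 5 by simp
next
  case (6 m b k)
  have "k < length m" "m ! k \<noteq> 0" using first_nonzero 6 by simp_all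
  then show ?case using 6 by (simp add: coeff_size_uminus first_nonzero_uminus)
qed

text \<open>The defining equation is not a terminating rewrite rule.\<close>

declare extr.simps [simp del]

definition ext :: "network \<Rightarrow> subst_graph" where
  "ext N = map Var [0..<inputs N] #
     map (map (\<lambda>v. extr (weights v) (bias v))) (levels (to_sigma N))"

definition network_derivable :: "(formula \<times> formula) set \<Rightarrow> network \<Rightarrow> network \<Rightarrow> bool" where
  "network_derivable E N1 N2 \<longleftrightarrow> derivable E (represented (ext N1)) (represented (ext N2))"

end

theory Submission
  imports Defs
begin

text \<open>The networks enter only through the soundness of the extraction: \<open>represented (ext N)\<close>
  evaluates to the clipped realization of \<open>N\<close>.  What remains is that \<open>RMV\<close> is complete: an
  equation valid in \<open>[0, 1]\<close> holds in every Riesz MV-algebra, in particular in the algebra of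
  formulae modulo derivability.

  The proof of completeness is direct, without prime ideals.  The scalars allow every element to
  be shrunk, so that \<open>1 / 2 + \<epsilon> a\<close> makes sense inside the algebra and sums of such elements do not
  overflow.  For small \<open>\<epsilon>\<close> the element \<open>1 / 2 + \<epsilon> \<phi>\<close> is an infimum of suprema of affine
  combinations of the generators.  If \<open>\<phi>\<close> is identically 1 on the cube, then each of the suprema
  is at least \<open>1 / 2 + \<epsilon>\<close> there, and by the Farkas lemma so is already some convex combination of its
  members; for a single affine form this can be read off the coefficients, hence it holds in the
  algebra.  A supremum dominates the convex combinations of its members, so
  \<open>1 / 2 + \<epsilon> \<le> 1 / 2 + \<epsilon> \<phi>\<close> in the algebra, and \<open>\<phi> = 1\<close> follows by cancellation.\<close>

section \<open>MV-algebras and Riesz MV-algebras\<close>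

text \<open>\<open>+\<close>, \<open>*\<close> and unary \<open>-\<close> are \<open>\<oplus>\<close>, \<open>\<odot>\<close> and \<open>\<not>\<close>.\<close>

class mv_algebra = comm_monoid_add + comm_monoid_mult + uminus + inf + sup + ord +
  assumes add_uminus: "x + - x = 1"
    and add_one: "x + 1 = 1"
    and mult_zero: "x * 0 = 0"
    and uminus_add: "- (x + y) = - x * - y"
    and uminus_uminus: "- (- x) = x"
    and uminus_zero: "- 0 = 1"
    and sup_swap: "x * - y + y = y * - x + x"
    and less_eq_iff: "x \<le> y \<longleftrightarrow> - x + y = 1"
    and less_iff: "x < y \<longleftrightarrow> x \<le> y \<and> \<not> y \<le> x"
    and inf_eq: "inf x y = (x + - y) * y"
    and sup_eq: "sup x y = x * - y + y"
begin

lemma uminus_mult: "- (x * y) = - x + - y"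
  by (metis uminus_add uminus_uminus)

lemma uminus_one: "- 1 = 0"
  by (metis uminus_zero uminus_uminus)

lemma mult_uminus: "x * - x = 0"
  by (metis add_uminus uminus_add uminus_one uminus_uminus)

section \<open>Order and lattice structure of MV-algebras\<close>

lemma le_iff_mult: "x \<le> y \<longleftrightarrow> x * - y = 0"
  by (metis less_eq_iff uminus_mult uminus_one uminus_uminus)

lemma le_iff_add: "x \<le> y \<longleftrightarrow> (\<exists>z. y = x + z)"
proof
  assume "x \<le> y"
  \<comment> \<open>The witness is the truncated difference \<open>y * - x\<close>: in
    \<open>sup_swap\<close> the summand \<open>x * - y\<close> vanishes.\<close>
  then have "y = x + y * - x"
    using sup_swap[of x y] by (simp add: le_iff_mult add.commute)
  then show "\<exists>z. y = x + z" ..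
next
  assume "\<exists>z. y = x + z"
  then show "x \<le> y"
    by (metis less_eq_iff add.assoc add.commute add_one add_uminus)
qed

subclass order
proof
  fix x y z :: 'a
  show "x < y \<longleftrightarrow> x \<le> y \<and> \<not> y \<le> x" by (rule less_iff)
  show "x \<le> x" by (simp add: le_iff_mult mult_uminus)
  show "x \<le> z" if "x \<le> y" "y \<le> z" using that by (metis le_iff_add add.assoc)
  show "x = y" if "x \<le> y" "y \<le> x" using that sup_swap[of x y] by (simp add: le_iff_mult)
qed

subclass ordered_comm_monoid_add
  by unfold_locales (metis le_iff_add add.assoc)

lemma uminus_le_iff: "- x \<le> - y \<longleftrightarrow> y \<le> x"
  by (metis less_eq_iff uminus_uminus add.commute)

lemma mult_mono_left: "x \<le> y \<Longrightarrow> z * x \<le> z * y"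
  by (metis add_left_mono uminus_le_iff uminus_mult)

text \<open>Residuation: by De Morgan both sides unfold to the same equation. Being a left adjoint,
  \<open>*\<close> preserves suprema, which is \<open>mult_sup_distrib\<close>.\<close>

lemma mult_le_iff: "x * y \<le> z \<longleftrightarrow> x \<le> - y + z"
  by (simp add: less_eq_iff uminus_mult add.assoc)

lemma le_one: "x \<le> 1"
  by (metis less_eq_iff add_one)

lemma zero_le: "0 \<le> x"
  by (metis le_iff_add add_0)

lemma mult_le_left: "x * y \<le> x"
  by (metis le_one mult_mono_left mult_1_right)

lemma mult_le_right: "x * y \<le> y"
  by (metis mult_le_left mult.commute)

lemma inf_uminus: "- inf x y = sup (- x) (- y)"
  by (simp add: inf_eq sup_eq uminus_mult uminus_add uminus_uminus)

lemma sup_commute': "sup x y = sup y x"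
  by (simp add: sup_eq sup_swap)

lemma sup_upper: "y \<le> sup x y"
  by (metis sup_eq le_iff_add add.commute)

text \<open>The defining term makes \<open>sup\<close> monotone in its first argument, and
  \<open>sup_swap\<close> collapses \<open>sup z y\<close> to \<open>z\<close>.\<close>

lemma sup_lub:
  assumes "x \<le> z" "y \<le> z"
  shows "sup x y \<le> z"
proof -
  have "x * - y \<le> z * - y"
    using mult_mono_left[OF assms(1), of "- y"] by (simp add: mult.commute)
  then have "sup x y \<le> sup z y"
    by (simp add: sup_eq add_right_mono)
  also have "\<dots> = z"
    using assms(2) sup_swap[of z y] by (simp add: sup_eq le_iff_mult)
  finally show ?thesis .
qed

subclass lattice
proof
  fix x y z :: 'a
  show "x \<le> sup x y" "y \<le> sup x y" using sup_upper sup_commute' by metis+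
  show "sup y z \<le> x" if "y \<le> x" "z \<le> x" using that by (rule sup_lub)
  show "inf x y \<le> x" "inf x y \<le> y"
    by (metis inf_uminus sup_upper sup_commute' uminus_le_iff)+
  show "x \<le> inf y z" if "x \<le> y" "x \<le> z"
    using that by (metis inf_uminus sup_lub uminus_le_iff)
qed

lemma mult_sup_distrib: "z * sup x y = sup (z * x) (z * y)"
proof (rule order.antisym)
  have "sup x y * z \<le> sup (z * x) (z * y)"
    unfolding mult_le_iff by (rule sup_lub) (simp_all flip: mult_le_iff add: mult.commute)
  then show "z * sup x y \<le> sup (z * x) (z * y)" by (simp add: mult.commute)
  show "sup (z * x) (z * y) \<le> z * sup x y"
    by (intro sup_lub mult_mono_left) simp_all
qed

lemma uminus_sup: "- sup x y = inf (- x) (- y)"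
  by (metis inf_uminus uminus_uminus)

lemma add_inf_distrib: "z + inf x y = inf (z + x) (z + y)"
proof -
  have "- (z + inf x y) = - inf (z + x) (z + y)"
    by (simp only: uminus_add inf_uminus mult_sup_distrib)
  then show ?thesis by (metis uminus_uminus)
qed

lemma inf_eq': "inf x y = y * (- y + x)"
  by (simp add: inf_eq ac_simps)

text \<open>The second factor of \<open>inf x ?w = (- ?w + x) * ?w\<close> distributes over the
  supremum; afterwards \<open>- ?w\<close> grows to \<open>- y\<close> or \<open>- z\<close> in the
  first factor.\<close>

lemma inf_sup_le: "inf x (sup y z) \<le> sup (inf x y) (inf x z)"
proof -
  let ?w = "sup y z"
  have "inf x ?w = (- ?w + x) * ?w"
    by (simp add: inf_eq' mult.commute)
  also have "\<dots> = sup ((- ?w + x) * y) ((- ?w + x) * z)"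
    by (rule mult_sup_distrib)
  also have "\<dots> \<le> sup (inf x y) (inf x z)"
    unfolding inf_eq' by (intro sup_mono)
      (subst mult.commute, intro mult_mono_left add_right_mono, simp add: uminus_le_iff)+
  finally show ?thesis .
qed

subclass distrib_lattice
proof
  have D: "inf x (sup y z) = sup (inf x y) (inf x z)" for x y z
    by (rule order.antisym[OF inf_sup_le]) (rule distrib_inf_le)
  show "sup x (inf y z) = inf (sup x y) (sup x z)" for x y z
    by (rule distrib_imp1[OF D])
qed

text \<open>Sums that do not overflow, that is \<open>x + y\<close> with \<open>x \<le> - y\<close>, are cancellative.\<close>

lemma add_mult_uminus: "x \<le> - y \<Longrightarrow> (x + y) * - y = x"
  using inf_eq[of x "- y"] by (simp add: uminus_uminus inf_absorb1)

lemma mult_uminus_add: "y \<le> x \<Longrightarrow> x * - y + y = x"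
  using sup_eq[of x y] by (simp add: sup_absorb1)

lemma le_uminus_commute: "x \<le> - y \<longleftrightarrow> y \<le> - x"
  by (metis uminus_le_iff uminus_uminus)

text \<open>Associativity of the sum that does not overflow. The factor \<open>- y\<close> recovers
  \<open>x\<close> from \<open>x + y\<close>, so the bound on \<open>x + y\<close> carries over to
  \<open>x\<close>.\<close>

lemma disjoint_assoc:
  assumes "x \<le> - y" "x + y \<le> - z"
  shows "y \<le> - z" "x \<le> - (y + z)"
proof -
  show "y \<le> - z" using assms(2) by (metis add.commute le_iff_add order.trans)
  have "x = (x + y) * - y" using assms(1) by (simp add: add_mult_uminus)
  also have "\<dots> \<le> - z * - y" using mult_mono_left[OF assms(2), of "- y"] by (simp add: mult.commute)
  finally show "x \<le> - (y + z)" by (simp add: uminus_add mult.commute)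
qed

lemma add_le_cancel:
  assumes "y \<le> - z" "x + z \<le> y + z"
  shows "x \<le> - z \<Longrightarrow> x \<le> y"
  using assms add_mult_uminus mult_mono_left by (metis mult.commute)

text \<open>On elements below \<open>- z\<close>, multiplication by \<open>- z\<close> undoes the
  addition of \<open>z\<close>. So the upper bound \<open>?s\<close> can be lowered by
  \<open>z\<close>, compared with the supremum, and raised again.\<close>

lemma add_sup_distrib:
  assumes "x \<le> - z" "y \<le> - z"
  shows "sup x y + z = sup (x + z) (y + z)"
proof (rule order.antisym)
  let ?s = "sup (x + z) (y + z)"
  have s: "z \<le> ?s" by (metis le_iff_add add.commute le_supI1)
  have "w \<le> ?s * - z" if "w \<le> - z" "w + z \<le> ?s" for w
    using that by (metis add_mult_uminus mult_mono_left mult.commute)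
  then have "sup x y \<le> ?s * - z"
    using assms by (intro sup_lub) simp_all
  then have "sup x y + z \<le> ?s * - z + z" by (rule add_right_mono)
  also have "\<dots> = ?s" using s by (rule mult_uminus_add)
  finally show "sup x y + z \<le> ?s" .
  show "?s \<le> sup x y + z" by (intro sup_lub add_right_mono) simp_all
qed

end

section \<open>Riesz MV-algebras and the arithmetic of scalars\<close>

class riesz_mv_algebra = mv_algebra +
  fixes delta :: "real \<Rightarrow> 'a \<Rightarrow> 'a"
  assumes delta_mult_uminus: "r \<in> {0..1} \<Longrightarrow> delta r (x * - y) = delta r x * - delta r y"
    and delta_diff: "r \<in> {0..1} \<Longrightarrow> q \<in> {0..1} \<Longrightarrow>
      delta (max 0 (r - q)) x = delta r x * - delta q x"
    and delta_delta: "r \<in> {0..1} \<Longrightarrow> q \<in> {0..1} \<Longrightarrow> delta r (delta q x) = delta (r * q) x"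
    and delta_one_left: "delta 1 x = x"
begin

lemma delta_zero_left [simp]: "delta 0 x = 0"
  using delta_diff[of 0 0 x] by (simp add: mult_uminus)

lemma delta_zero_right [simp]: "r \<in> {0..1} \<Longrightarrow> delta r 0 = 0"
  using delta_mult_uminus[of r 0 0] by (simp add: mult_uminus)

lemma delta_mono: "r \<in> {0..1} \<Longrightarrow> x \<le> y \<Longrightarrow> delta r x \<le> delta r y"
  using delta_mult_uminus[of r x y] by (simp add: le_iff_mult)

lemma delta_mono_left: "0 \<le> r \<Longrightarrow> r \<le> q \<Longrightarrow> q \<le> 1 \<Longrightarrow> delta r x \<le> delta q x"
  using delta_diff[of r q x] by (simp add: le_iff_mult)

text \<open>The scalar axiom presents \<open>delta r x\<close> as the truncated difference of
  \<open>delta (r + q) x\<close> and \<open>delta q x\<close>; adding the subtrahend back is exact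
  because it is the smaller of the two.\<close>

lemma delta_add_left:
  assumes "0 \<le> r" "0 \<le> q" "r + q \<le> 1"
  shows "delta (r + q) x = delta r x + delta q x"
proof -
  have "delta r x = delta (r + q) x * - delta q x"
    using delta_diff[of "r + q" q x] assms by simp
  then show ?thesis
    using mult_uminus_add[OF delta_mono_left[of q "r + q" x]] assms by simp
qed

lemma delta_disjoint: "0 \<le> r \<Longrightarrow> 0 \<le> q \<Longrightarrow> r + q \<le> 1 \<Longrightarrow> delta r x \<le> - delta q x"
  using delta_diff[of "r + q" q x] mult_le_right[of "delta (r + q) x"] by simp

lemma delta_add:
  assumes "r \<in> {0..1}" "x \<le> - y"
  shows "delta r (x + y) = delta r x + delta r y" "delta r x \<le> - delta r y"
proof -
  have *: "delta r x = delta r (x + y) * - delta r y"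
    using add_mult_uminus[OF assms(2)] delta_mult_uminus[OF assms(1)] by metis
  have "delta r y \<le> delta r (x + y)"
    using assms(1) by (intro delta_mono) (auto simp: le_iff_add add.commute)
  then show "delta r (x + y) = delta r x + delta r y"
    using * by (simp add: mult_uminus_add)
  show "delta r x \<le> - delta r y"
    unfolding * by (rule mult_le_right)
qed

lemma delta_sup: "r \<in> {0..1} \<Longrightarrow> delta r (sup x y) = sup (delta r x) (delta r y)"
  unfolding sup_eq
  by (subst delta_add) (auto simp: delta_mult_uminus mult_le_right)

lemma delta_inf: "r \<in> {0..1} \<Longrightarrow> delta r (inf x y) = inf (delta r x) (delta r y)"
proof -
  \<comment> \<open>\<open>delta\<close> respects truncated differences \<open>a * - b\<close> by
    axiom, so \<open>inf\<close> is written as a nested one.\<close>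
  have *: "inf a b = b * - (b * - a)" for a b
    by (simp add: inf_eq uminus_mult uminus_uminus ac_simps)
  show "r \<in> {0..1} \<Longrightarrow> ?thesis"
    unfolding * by (simp add: delta_mult_uminus)
qed

lemma delta_le: "r \<in> {0..1} \<Longrightarrow> delta r x \<le> delta r 1"
  by (intro delta_mono le_one)

lemma delta_add_uminus: "r \<in> {0..1} \<Longrightarrow> delta r x + delta r (- x) = delta r 1"
  using delta_add(1)[of r x "- x"] by (simp add: add_uminus uminus_uminus)

text \<open>The truncation at 1 becomes one at \<open>delta r 1\<close>. With the overflow discarded
  first, \<open>x + y = inf y (- x) + x\<close> is a disjoint sum, over which \<open>delta r\<close>
  distributes.\<close>

lemma delta_add_clip:
  assumes "r \<in> {0..1}"
  shows "delta r (x + y) = inf (delta r 1) (delta r x + delta r y)"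
proof -
  have "(x + y) * - x + x = x + y"
    by (rule mult_uminus_add) (auto simp: le_iff_add)
  then have "x + y = inf y (- x) + x"
    by (simp add: inf_eq uminus_uminus add.commute)
  then have "delta r (x + y) = inf (delta r y) (delta r (- x)) + delta r x"
    using assms delta_add(1)[of r "inf y (- x)" x] by (simp add: delta_inf)
  also have "\<dots> = delta r x + inf (delta r y) (delta r (- x))"
    by (simp add: add.commute)
  also have "\<dots> = inf (delta r x + delta r y) (delta r 1)"
    by (simp add: add_inf_distrib delta_add_uminus[OF assms])
  finally show ?thesis by (simp add: inf_commute)
qed

text \<open>The constants \<open>delta s 1\<close> measure sizes: elements whose sizes total at most
  1 can be added without overflow.\<close>

lemma bounded_disjoint:
  assumes "x \<le> delta s 1" "y \<le> delta t 1" "0 \<le> s" "0 \<le> t" "s + t \<le> 1"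
  shows "x \<le> - y"
proof -
  have "delta s 1 \<le> - delta t 1" using assms by (intro delta_disjoint)
  also have "\<dots> \<le> - y" using assms by (simp add: uminus_le_iff)
  finally show ?thesis using assms(1) by simp
qed

lemma bounded_add:
  assumes "x \<le> delta s 1" "y \<le> delta t 1" "0 \<le> s" "0 \<le> t" "s + t \<le> 1"
  shows "x + y \<le> delta (s + t) 1"
  using assms by (simp add: delta_add_left add_mono)

text \<open>An Archimedean argument: some \<open>e = 1 / (N + 1)\<close> lies below
  \<open>r\<close>, so \<open>delta e x\<close> vanishes too, and \<open>x\<close> is the sum of
  \<open>N + 1\<close> copies of it.\<close>

lemma delta_eq_zero:
  assumes "0 < r" "r \<le> 1" "delta r x = 0"
  shows "x = 0"
proof -
  obtain N :: nat where N: "inverse (real (Suc N)) < r"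
    using reals_Archimedean[OF assms(1)] by blast
  define e where "e = inverse (real (Suc N))"
  have e: "0 < e" "e \<le> r" "real (Suc N) * e = 1" using N by (auto simp: e_def)
  have "delta e x \<le> delta r x" using e assms by (intro delta_mono_left) auto
  then have x: "delta e x = 0" using assms(3) zero_le order.antisym by metis
  have "delta (real k * e) x = 0" if "k \<le> Suc N" for k
    using that
  proof (induction k)
    case (Suc k)
    have "real (Suc k) * e \<le> real (Suc N) * e"
      using Suc.prems e(1) by (intro mult_right_mono) auto
    then have "real k * e + e \<le> 1" using e(3) by (simp add: algebra_simps)
    then have "delta (real k * e + e) x = delta (real k * e) x + delta e x"
      using e(1) by (intro delta_add_left) auto
    then show ?case using Suc x by (simp add: algebra_simps)
  qed simp
  from this[of "Suc N"] show ?thesis unfolding e(3) by (simp add: delta_one_left)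
qed

end

section \<open>The Farkas lemma on the cube\<close>

text \<open>Fourier-Motzkin elimination, one variable per induction step, inside the set
  \<open>C\<close>. Closure under \<open>drop\<close> replaces the term of a variable by its minimum
  over \<open>{0..1}\<close>; closure under \<open>convex\<close> lets two forms with coefficients
  of opposite sign cancel a variable. If at each point of the cube some form of \<open>F\<close> is
  nonnegative, a single constant form remains in the end.\<close>

lemma farkas_cube:
  fixes C F :: "((nat \<Rightarrow> real) \<times> real) set"
  assumes convex: "\<And>m b m' b' t. (m, b) \<in> C \<Longrightarrow> (m', b') \<in> C \<Longrightarrow> 0 \<le> t \<Longrightarrow> t \<le> 1 \<Longrightarrow>
      (\<lambda>i. t * m i + (1 - t) * m' i, t * b + (1 - t) * b') \<in> C"
    and drop: "\<And>m b i. (m, b) \<in> C \<Longrightarrow> i < n \<Longrightarrow> (m(i := 0), b + min (m i) 0) \<in> C"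
    and "k \<le> n" "finite F" "F \<subseteq> C" "\<forall>(m, b) \<in> F. \<forall>i. k \<le> i \<and> i < n \<longrightarrow> m i = 0"
    and "\<And>v. (\<And>i. 0 \<le> v i \<and> v i \<le> 1) \<Longrightarrow> \<exists>(m, b) \<in> F. 0 \<le> (\<Sum>i<k. m i * v i) + b"
  shows "\<exists>(m, b) \<in> C. (\<forall>i<n. m i = 0) \<and> 0 \<le> b"
  using assms(3-)
proof (induction k arbitrary: F)
  case 0
  have "\<exists>(m, b) \<in> F. 0 \<le> b" using "0.prems"(5)[of "\<lambda>_. 0"] by simp
  then obtain m b where "(m, b) \<in> F" "0 \<le> b" by blast
  moreover from this have "\<forall>i<n. m i = 0" using "0.prems"(4) by fast
  ultimately show ?case using "0.prems"(3) by blast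
next
  case (Suc k)
  \<comment> \<open>The weight for which the convex combination has coefficient 0 at
    \<open>k\<close>.\<close>
  define t where "t m m' = - m' k / (m k - m' k)" for m m' :: "nat \<Rightarrow> real"
  define comb where "comb p q = (\<lambda>i. t (fst p) (fst q) * fst p i + (1 - t (fst p) (fst q)) * fst q i,
      t (fst p) (fst q) * snd p + (1 - t (fst p) (fst q)) * snd q)" for p q :: "(nat \<Rightarrow> real) \<times> real"
  define cut where "cut p = ((fst p)(k := 0), snd p + min (fst p k) 0)" for p :: "(nat \<Rightarrow> real) \<times> real"
  define P where "P = {p \<in> F. 0 < fst p k}"
  define Q where "Q = {p \<in> F. fst p k < 0}"
  define F' where "F' = cut ` F \<union> (\<lambda>(p, q). comb p q) ` (P \<times> Q)"
  have fin: "finite P" "finite Q" using Suc.prems(2) by (auto simp: P_def Q_def)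
  have t: "0 \<le> t (fst p) (fst q)" "t (fst p) (fst q) \<le> 1"
    "t (fst p) (fst q) * fst p k + (1 - t (fst p) (fst q)) * fst q k = 0"
    if "p \<in> P" "q \<in> Q" for p q
  proof -
    have "0 < fst p k" "fst q k < 0" using that by (auto simp: P_def Q_def)
    then have pos: "0 < fst p k - fst q k" by simp
    show "0 \<le> t (fst p) (fst q)" "t (fst p) (fst q) \<le> 1"
      using pos \<open>fst q k < 0\<close> \<open>0 < fst p k\<close> by (auto simp: t_def pos_le_divide_eq pos_divide_le_eq le_minus_iff minus_divide_left
        simp del: minus_divide_left [symmetric])
    have "t (fst p) (fst q) * (fst p k - fst q k) = - fst q k" using pos by (simp add: t_def)
    then show "t (fst p) (fst q) * fst p k + (1 - t (fst p) (fst q)) * fst q k = 0"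
      by (simp add: algebra_simps)
  qed
  show ?case
  proof (rule Suc.IH[of F'])
    show "k \<le> n" using Suc.prems(1) by simp
    show "finite F'" using Suc.prems(2) fin by (simp add: F'_def)
    show "F' \<subseteq> C"
    proof
      fix r assume "r \<in> F'"
      then consider p where "p \<in> F" "r = cut p" | p q where "p \<in> P" "q \<in> Q" "r = comb p q"
        unfolding F'_def by auto
      then show "r \<in> C"
      proof cases
        case 1
        then show ?thesis
          using drop[of "fst p" "snd p" k] Suc.prems(1,3) by (auto simp: cut_def)
      next
        case 2
        then show ?thesis
          using convex[of "fst p" "snd p" "fst q" "snd q"] t[of p q] Suc.prems(3)
          by (auto simp: comb_def P_def Q_def)
      qed
    qed
    show "\<forall>(m, b)\<in>F'. \<forall>i. k \<le> i \<and> i < n \<longrightarrow> m i = 0"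
    proof -
      have "fst r i = 0" if "r \<in> F'" "k \<le> i" "i < n" for r i
      proof -
        have F: "fst p i = 0" if "p \<in> F" "i \<noteq> k" for p
          using that Suc.prems(4) \<open>k \<le> i\<close> \<open>i < n\<close> by (auto simp: Suc_le_eq)
        from \<open>r \<in> F'\<close> consider p where "p \<in> F" "r = cut p" | p q where "p \<in> P" "q \<in> Q" "r = comb p q"
          unfolding F'_def by auto
        then show ?thesis
        proof cases
          case 1
          then show ?thesis using F by (auto simp: cut_def)
        next
          case 2
          then show ?thesis using F t(3)[of p q] by (cases "i = k") (auto simp: comb_def P_def Q_def)
        qed
      qed
      then show ?thesis by auto
    qed
    fix v :: "nat \<Rightarrow> real" assume v: "\<And>i. 0 \<le> v i \<and> v i \<le> 1"
    define g where "g p = (\<Sum>i<k. fst p i * v i) + snd p" for p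
    show "\<exists>(m, b)\<in>F'. 0 \<le> (\<Sum>i<k. m i * v i) + b"
    proof (rule ccontr)
      \<comment> \<open>If all of \<open>F'\<close> is negative at \<open>v\<close>, there is a
        value \<open>s\<close> for the variable \<open>k\<close> at which all of \<open>F\<close> is
        negative.\<close>
      assume "\<not> ?thesis"
      then have neg: "g r < 0" if "r \<in> F'" for r
        using that by (force simp: g_def)
      have cut: "g p + min (fst p k) 0 < 0" if "p \<in> F" for p
        using neg[of "cut p"] that by (simp add: F'_def g_def cut_def)
      have comb: "fst p k * g q < fst q k * g p" if "p \<in> P" "q \<in> Q" for p q
      proof -
        let ?s = "t (fst p) (fst q)"
        have "g (comb p q) = ?s * g p + (1 - ?s) * g q"
          by (simp add: g_def comb_def algebra_simps sum.distrib sum_distrib_left sum_subtractf)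
        moreover have "g (comb p q) < 0" using that by (intro neg) (force simp: F'_def)
        moreover have "fst p k - fst q k > 0" using that by (auto simp: P_def Q_def)
        ultimately have "(?s * g p + (1 - ?s) * g q) * (fst p k - fst q k) < 0"
          by (simp add: mult_neg_pos)
        moreover have "(?s * g p + (1 - ?s) * g q) * (fst p k - fst q k) = - fst q k * g p + fst p k * g q"
          proof -
          have "?s * (fst p k - fst q k) = - fst q k"
            using \<open>fst p k - fst q k > 0\<close> by (simp add: t_def)
          then show ?thesis by algebra
        qed
        ultimately show ?thesis by simp
      qed
      \<comment> \<open>For negativity at \<open>s\<close>, the forms in \<open>Q\<close> require
        \<open>s\<close> to exceed \<open>- g q / fst q k\<close>, those in \<open>P\<close> require
        it to stay below \<open>- g p / fst p k\<close>; 0 and 1 delimit the cube.\<close>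
      define lo where "lo = Max (insert 0 ((\<lambda>q. - g q / fst q k) ` Q))"
      define hi where "hi = Min (insert 1 ((\<lambda>p. - g p / fst p k) ` P))"
      have lo: "0 \<le> lo" "\<And>q. q \<in> Q \<Longrightarrow> - g q / fst q k \<le> lo"
        using fin by (auto simp: lo_def)
      have hi: "hi \<le> 1" "\<And>p. p \<in> P \<Longrightarrow> hi \<le> - g p / fst p k"
        using fin by (auto simp: hi_def)
      \<comment> \<open>\<open>cut\<close> compares the bounds from \<open>P\<close> with 0 and
        those from \<open>Q\<close> with 1, \<open>comb\<close> compares \<open>Q\<close> with
        \<open>P\<close>.\<close>
      have "lo < hi"
      proof -
        have "0 < - g p / fst p k" if "p \<in> P" for p
          using that cut[of p] by (auto simp: P_def intro: divide_neg_pos)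
        moreover have "- g q / fst q k < 1" if "q \<in> Q" for q
        proof -
          have "fst q k < 0" "g q + fst q k < 0" using that cut[of q] by (auto simp: Q_def)
          then show ?thesis by (subst neg_divide_less_eq) auto
        qed
        moreover have "- g q / fst q k < - g p / fst p k" if "p \<in> P" "q \<in> Q" for p q
        proof -
          have "0 < fst p k" "fst q k < 0" using that by (auto simp: P_def Q_def)
          have "- g q / fst q k = g q / - fst q k" by simp
          also have "\<dots> < - g p / fst p k"
            using comb[OF that] \<open>0 < fst p k\<close> \<open>fst q k < 0\<close>
            by (subst pos_divide_less_eq, simp, subst times_divide_eq_left, subst pos_less_divide_eq)
              (simp_all add: algebra_simps)
          finally show ?thesis .
        qed
        ultimately show ?thesis
          unfolding lo_def hi_def using fin by (auto simp: Max_less_iff)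
      qed
      define s where "s = (lo + hi) / 2"
      have s: "lo < s" "s < hi" using \<open>lo < hi\<close> by (auto simp: s_def)
      have "g p + fst p k * s < 0" if F: "p \<in> F" for p
      proof -
        consider "p \<in> P" | "p \<in> Q" | "fst p k = 0" using F by (force simp: P_def Q_def)
        then show ?thesis
        proof cases
          case 1
          then have "0 < fst p k" "s < - g p / fst p k" using hi(2)[of p] s(2) by (auto simp: P_def)
          then show ?thesis by (subst (asm) pos_less_divide_eq) (auto simp: mult.commute)
        next
          case 2
          then have "fst p k < 0" "- g p / fst p k < s" using lo(2)[of p] s(1) by (auto simp: Q_def)
          then show ?thesis by (subst (asm) neg_divide_less_eq) (auto simp: mult.commute)
        next
          case 3
          then show ?thesis using cut[OF F] by simp
        qed
      qed
      moreover have "\<exists>(m, b)\<in>F. 0 \<le> (\<Sum>i<Suc k. m i * (v(k := s)) i) + b"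
        by (rule Suc.prems(5)) (use v s lo(1) hi(1) in auto)
      then obtain p where "p \<in> F" "0 \<le> (\<Sum>i<Suc k. fst p i * (v(k := s)) i) + snd p" by auto
      moreover have "(\<Sum>i<Suc k. fst p i * (v(k := s)) i) + snd p = g p + fst p k * s"
        by (simp add: g_def)
      ultimately show False by fastforce
    qed
  qed
qed

section \<open>Affine combinations of generators\<close>

text \<open>Both claims go by one induction: the bound on the partial sum supplies the disjointness
  that \<open>delta_add\<close> asks for.\<close>

lemma delta_sum:
  fixes a :: "'i \<Rightarrow> 'a::riesz_mv_algebra"
  assumes "finite I" "\<And>i. i \<in> I \<Longrightarrow> 0 \<le> s i \<and> a i \<le> delta (s i) 1" "sum s I \<le> 1"
  shows "sum a I \<le> delta (sum s I) 1"
    and "r \<in> {0..1} \<Longrightarrow> delta r (sum a I) = (\<Sum>i\<in>I. delta r (a i))"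
proof -
  have "sum a I \<le> delta (sum s I) 1 \<and>
      (r \<in> {0..1} \<longrightarrow> delta r (sum a I) = (\<Sum>i\<in>I. delta r (a i)))"
    using assms
  proof (induction I)
    case (insert i I)
    have s: "0 \<le> s i" "0 \<le> sum s I" "s i + sum s I \<le> 1"
      using insert by (auto intro: sum_nonneg)
    have "sum s I \<le> 1" using s by linarith
    then have IH: "sum a I \<le> delta (sum s I) 1"
        "r \<in> {0..1} \<Longrightarrow> delta r (sum a I) = (\<Sum>i\<in>I. delta r (a i))"
      using insert.IH insert.prems(1) by auto
    have ai: "a i \<le> delta (s i) 1" using insert by simp
    have "a i \<le> - sum a I" using ai IH(1) s by (intro bounded_disjoint[of _ "s i" _ "sum s I"]) auto
    then show ?case
      using insert IH s ai bounded_add[of "a i" "s i" "sum a I" "sum s I"] by (simp add: delta_add(1))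
  qed (simp add: zero_le)
  then show "sum a I \<le> delta (sum s I) 1"
    "r \<in> {0..1} \<Longrightarrow> delta r (sum a I) = (\<Sum>i\<in>I. delta r (a i))" by auto
qed

text \<open>\<open>a\<close> and \<open>a'\<close> split the constant \<open>delta s 1\<close>
  without overflow. For \<open>s = 1\<close> this says \<open>a' = - a\<close>, so a negation can be
  computed summand by summand.\<close>

definition complementary :: "real \<Rightarrow> 'a::riesz_mv_algebra \<Rightarrow> 'a \<Rightarrow> bool" where
  "complementary s a a' \<longleftrightarrow> 0 \<le> s \<and> a + a' = delta s 1 \<and> a \<le> - a'"

lemma complementary_add:
  assumes "complementary s a a'" "complementary t b b'" "s + t \<le> 1"
  shows "complementary (s + t) (a + b) (a' + b')"
proof -
  have st: "0 \<le> s" "0 \<le> t" and a: "a + a' = delta s 1" "a \<le> - a'"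
    and b: "b + b' = delta t 1" "b \<le> - b'"
    using assms by (auto simp: complementary_def)
  \<comment> \<open>The two constants are disjoint because \<open>s + t \<le> 1\<close>;
    \<open>disjoint_assoc\<close> then regroups the four summands.\<close>
  have ab: "a + a' \<le> - (b + b')" unfolding a b using st assms(3) by (intro delta_disjoint) auto
  have 1: "a' \<le> - (b + b')" "a \<le> - (a' + (b + b'))" using disjoint_assoc[OF a(2) ab] by auto
  have 2: "b' \<le> - a'" "b \<le> - (b' + a')"
    using disjoint_assoc[OF b(2)] 1(1) by (auto simp: le_uminus_commute)
  have "(a' + b') \<le> - b" using 2(2) by (simp add: le_uminus_commute add.commute)
  moreover have "(a' + b') + b \<le> - a" using 1(2) by (simp add: le_uminus_commute ac_simps)
  ultimately have "b \<le> - a" "a' + b' \<le> - (b + a)" using disjoint_assoc by blast+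
  then have "a + b \<le> - (a' + b')" by (simp add: le_uminus_commute add.commute)
  moreover have "(a + b) + (a' + b') = delta (s + t) 1"
    using a(1) b(1) st assms(3) by (simp add: delta_add_left flip: a(1) b(1)) (simp add: ac_simps)
  ultimately show ?thesis using st by (simp add: complementary_def)
qed

lemma complementary_delta: "r \<in> {0..1} \<Longrightarrow> complementary r (delta r a) (delta r (- a))"
  using delta_add(2)[of r a "- a"] by (simp add: complementary_def delta_add_uminus uminus_uminus)

lemma complementary_sum:
  assumes "finite I" "\<And>i. i \<in> I \<Longrightarrow> complementary (s i) (a i) (a' i)" "sum s I \<le> 1"
  shows "complementary (sum s I) (sum a I) (sum a' I)"
  using assms
proof (induction I)
  case (insert i I)
  have "0 \<le> s i" using insert by (auto simp: complementary_def)
  then show ?case using insert by (simp add: complementary_add)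
qed (simp add: complementary_def zero_le)

lemma complementary_one: "complementary 1 a a' \<Longrightarrow> - a = a'"
  by (metis antisym complementary_def delta_one_left le_uminus_commute less_eq_iff uminus_uminus)

text \<open>Stands for \<open>\<mu> a + (\<kappa> - \<mu>) / 2\<close>; it is affine in \<open>\<mu>\<close>, whatever the sign.\<close>

definition weighted :: "real \<Rightarrow> real \<Rightarrow> 'a::riesz_mv_algebra \<Rightarrow> 'a" where
  "weighted \<kappa> \<mu> a = delta ((\<kappa> + \<mu>) / 2) a + delta ((\<kappa> - \<mu>) / 2) (- a)"

lemma weighted_total: "(\<kappa> + \<mu>) / 2 + (\<kappa> - \<mu>) / 2 = (\<kappa> :: real)"
  by (simp add: field_simps)

lemma weighted_le:
  assumes "\<bar>\<mu>\<bar> \<le> \<kappa>" "\<kappa> \<le> 1"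
  shows "weighted \<kappa> \<mu> a \<le> delta \<kappa> 1"
proof -
  have "weighted \<kappa> \<mu> a \<le> delta ((\<kappa> + \<mu>) / 2 + (\<kappa> - \<mu>) / 2) 1"
    unfolding weighted_def using assms by (intro bounded_add delta_le) (auto simp: weighted_total)
  then show ?thesis by (simp add: weighted_total)
qed

lemma convex_bounds:
  fixes t a b c :: real
  assumes "0 \<le> t" "t \<le> 1" "a \<le> c" "b \<le> c"
  shows "t * a + (1 - t) * b \<le> c"
  using convex_bound_le[of a c b t "1 - t"] assms by simp

lemma delta_convex_left:
  assumes "t \<in> {0..1}" "r \<in> {0..1}" "q \<in> {0..1}"
  shows "delta t (delta r a) + delta (1 - t) (delta q a) = delta (t * r + (1 - t) * q) a"
  using assms convex_bounds[of t r 1 q] by (simp add: delta_delta delta_add_left)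

text \<open>Both coefficients in \<open>weighted\<close> are affine in the weight and stay in
  \<open>{0..1}\<close>, so signed weights need no case distinction.\<close>

lemma weighted_convex:
  assumes "t \<in> {0..1}" "\<bar>\<mu>\<bar> \<le> \<kappa>" "\<bar>\<nu>\<bar> \<le> \<kappa>" "\<kappa> \<le> 1"
  shows "weighted \<kappa> (t * \<mu> + (1 - t) * \<nu>) a
    = delta t (weighted \<kappa> \<mu> a) + delta (1 - t) (weighted \<kappa> \<nu> a)"
proof -
  have split: "delta r (weighted \<kappa> \<mu> a) = delta r (delta ((\<kappa> + \<mu>) / 2) a) + delta r (delta ((\<kappa> - \<mu>) / 2) (- a))"
    if "r \<in> {0..1}" "\<bar>\<mu>\<bar> \<le> \<kappa>" for r \<mu>
    unfolding weighted_def using that assms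
    by (intro delta_add bounded_disjoint[of _ "(\<kappa> + \<mu>) / 2" _ "(\<kappa> - \<mu>) / 2"] delta_le) (auto simp: weighted_total)
  have e: "(\<kappa> + (t * \<mu> + (1 - t) * \<nu>)) / 2 = t * ((\<kappa> + \<mu>) / 2) + (1 - t) * ((\<kappa> + \<nu>) / 2)"
    "(\<kappa> - (t * \<mu> + (1 - t) * \<nu>)) / 2 = t * ((\<kappa> - \<mu>) / 2) + (1 - t) * ((\<kappa> - \<nu>) / 2)"
    by (auto simp: field_simps)
  have b: "(\<kappa> + \<mu>) / 2 \<in> {0..1}" "(\<kappa> - \<mu>) / 2 \<in> {0..1}" "(\<kappa> + \<nu>) / 2 \<in> {0..1}" "(\<kappa> - \<nu>) / 2 \<in> {0..1}"
    using assms by auto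
  have "1 - t \<in> {0..1}" using assms(1) by simp
  then show ?thesis
    unfolding split[OF assms(1,2)] split[OF \<open>1 - t \<in> _\<close> assms(3)]
    unfolding weighted_def e using b assms(1)
    by (simp only: flip: delta_convex_left) (simp add: ac_simps)
qed

lemma weighted_uminus: "weighted \<kappa> \<mu> (- a) = weighted \<kappa> (- \<mu>) a"
  by (simp add: weighted_def uminus_uminus add.commute)

lemma complementary_weighted:
  assumes "\<bar>\<mu>\<bar> \<le> \<kappa>" "\<kappa> \<le> 1"
  shows "complementary \<kappa> (weighted \<kappa> \<mu> a) (weighted \<kappa> (- \<mu>) a)"
proof -
  have "complementary ((\<kappa> + \<mu>) / 2 + (\<kappa> - \<mu>) / 2)
      (delta ((\<kappa> + \<mu>) / 2) a + delta ((\<kappa> - \<mu>) / 2) (- a))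
      (delta ((\<kappa> + \<mu>) / 2) (- a) + delta ((\<kappa> - \<mu>) / 2) (- (- a)))"
    using assms by (intro complementary_add complementary_delta) (auto simp: weighted_total)
  then show ?thesis by (simp add: weighted_total weighted_def uminus_uminus add.commute[of "delta ((\<kappa> - \<mu>) / 2) a"])
qed

lemma weighted_zero: "0 \<le> \<kappa> \<Longrightarrow> \<kappa> \<le> 1 \<Longrightarrow> weighted \<kappa> 0 a = delta (\<kappa> / 2) 1"
  by (simp add: weighted_def delta_add_uminus)

text \<open>Raising the weight from 0 to \<open>\<mu>\<close> adds \<open>\<mu> a\<close> but lowers
  the hidden constant by \<open>\<mu> / 2\<close>. That constant, put back on the left, splits into
  \<open>\<mu> / 2\<close> times \<open>a\<close> and \<open>\<mu> / 2\<close> times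
  \<open>- a\<close>.\<close>

lemma weighted_shift:
  assumes "0 \<le> \<mu>" "\<mu> \<le> \<kappa>" "\<kappa> \<le> 1" "0 \<le> d" "d + \<mu> / 2 \<le> 1"
  shows "weighted \<kappa> \<mu> a + delta (d + \<mu> / 2) 1 = weighted \<kappa> 0 a + delta d 1 + delta \<mu> a"
proof -
  have 1: "delta ((\<kappa> + \<mu>) / 2) a = delta (\<kappa> / 2) a + delta (\<mu> / 2) a"
    using assms delta_add_left[of "\<kappa> / 2" "\<mu> / 2" a] by (simp add: add_divide_distrib)
  have 2: "delta (\<kappa> / 2) (- a) = delta ((\<kappa> - \<mu>) / 2) (- a) + delta (\<mu> / 2) (- a)"
    using assms delta_add_left[of "(\<kappa> - \<mu>) / 2" "\<mu> / 2" "- a"] by (simp add: diff_divide_distrib)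
  have 3: "delta (d + \<mu> / 2) 1 = delta d 1 + (delta (\<mu> / 2) a + delta (\<mu> / 2) (- a))"
    using assms by (simp add: delta_add_left delta_add_uminus)
  have 4: "delta \<mu> a = delta (\<mu> / 2) a + delta (\<mu> / 2) a"
    using assms delta_add_left[of "\<mu> / 2" "\<mu> / 2" a] by simp
  show ?thesis unfolding weighted_def 1 3 4 by (simp add: 2 ac_simps)
qed

section \<open>Elements standing for affine functions of the generators\<close>

locale generated =
  fixes n :: nat and x :: "nat \<Rightarrow> 'a::riesz_mv_algebra"
  assumes n_pos: "0 < n"
begin

text \<open>The \<open>n\<close> weighted summands of \<open>affine_elt\<close> have size
  \<open>\<kappa>\<close> each, 1/4 together, which leaves room for the constant.\<close>

definition \<kappa> :: real where "\<kappa> = 1 / (4 * real n)"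

text \<open>The factor \<open>real n\<close> bounds each coefficient by \<open>\<kappa>\<close>; it
  also pays for moving a coefficient into the constant in \<open>small_drop\<close>.\<close>

definition small :: "(nat \<Rightarrow> real) \<Rightarrow> real \<Rightarrow> bool" where
  "small m b \<longleftrightarrow> \<bar>b\<bar> + real n * (\<Sum>i<n. \<bar>m i\<bar>) \<le> 1 / 4"

text \<open>Stands for \<open>1 / 2 + \<Sum> m\<^sub>i x\<^sub>i + b\<close>: the constant \<open>3 / 8\<close> is \<open>1 / 2 - n \<kappa> / 2\<close>.\<close>

definition affine_elt :: "(nat \<Rightarrow> real) \<Rightarrow> real \<Rightarrow> 'a" where
  "affine_elt m b = (\<Sum>i<n. weighted \<kappa> (m i) (x i)) + delta (3 / 8 + b + (\<Sum>i<n. m i) / 2) 1"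

lemma kappa: "0 \<le> \<kappa>" "\<kappa> \<le> 1" "real n * \<kappa> = 1 / 4"
  using n_pos by (auto simp: \<kappa>_def field_simps)

lemma smallD:
  assumes "small m b"
  shows "i < n \<Longrightarrow> \<bar>m i\<bar> \<le> \<kappa>" "1 / 8 \<le> 3 / 8 + b + (\<Sum>i<n. m i) / 2"
    "3 / 8 + b + (\<Sum>i<n. m i) / 2 \<le> 5 / 8" "\<bar>b\<bar> \<le> 1 / 4"
proof -
  let ?S = "\<Sum>i<n. \<bar>m i\<bar>"
  have S: "0 \<le> ?S" by (simp add: sum_nonneg)
  have "1 * ?S \<le> real n * ?S" using n_pos S by (intro mult_right_mono) auto
  moreover have "\<bar>\<Sum>i<n. m i\<bar> \<le> ?S" by (rule sum_abs)
  moreover have "\<bar>b\<bar> + real n * ?S \<le> 1 / 4" using assms by (simp add: small_def)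
  ultimately show "1 / 8 \<le> 3 / 8 + b + (\<Sum>i<n. m i) / 2"
    "3 / 8 + b + (\<Sum>i<n. m i) / 2 \<le> 5 / 8" "\<bar>b\<bar> \<le> 1 / 4"
    using S by linarith+
  show "\<bar>m i\<bar> \<le> \<kappa>" if "i < n"
  proof -
    have "\<bar>m i\<bar> \<le> ?S" using that by (intro member_le_sum) auto
    then have "real n * \<bar>m i\<bar> \<le> real n * ?S" by (intro mult_left_mono) auto
    then have "real n * \<bar>m i\<bar> \<le> real n * \<kappa>"
      using assms abs_ge_zero[of b] unfolding small_def kappa(3) by linarith
    then show ?thesis using n_pos by simp
  qed
qed

lemma small_uminus: "small (\<lambda>i. - m i) (- b) \<longleftrightarrow> small m b"
  by (simp add: small_def)

lemma small_convex:
  assumes "small m b" "small m' b'" "t \<in> {0..1}"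
  shows "small (\<lambda>i. t * m i + (1 - t) * m' i) (t * b + (1 - t) * b')"
proof -
  have abs: "\<bar>t * u + (1 - t) * w\<bar> \<le> t * \<bar>u\<bar> + (1 - t) * \<bar>w\<bar>" for u w
    using assms(3) abs_triangle_ineq[of "t * u" "(1 - t) * w"] by (simp add: abs_mult)
  have "\<bar>t * b + (1 - t) * b'\<bar> + real n * (\<Sum>i<n. \<bar>t * m i + (1 - t) * m' i\<bar>)
      \<le> (t * \<bar>b\<bar> + (1 - t) * \<bar>b'\<bar>) + real n * (\<Sum>i<n. t * \<bar>m i\<bar> + (1 - t) * \<bar>m' i\<bar>)"
    by (intro add_mono mult_left_mono sum_mono abs) auto
  also have "\<dots> = t * (\<bar>b\<bar> + real n * (\<Sum>i<n. \<bar>m i\<bar>)) + (1 - t) * (\<bar>b'\<bar> + real n * (\<Sum>i<n. \<bar>m' i\<bar>))"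
    unfolding sum.distrib sum_distrib_left[symmetric] by (simp add: algebra_simps)
  also have "\<dots> \<le> 1 / 4"
    using assms by (intro convex_bounds) (auto simp: small_def)
  finally show ?thesis by (simp add: small_def)
qed

lemma sum_fun_upd:
  fixes m :: "nat \<Rightarrow> real"
  assumes "i < n"
  shows "(\<Sum>j<n. f ((m(i := c)) j)) = (\<Sum>j<n. f (m j)) - f (m i) + (f c :: real)"
  using assms by (simp add: sum.remove[of _ i])

lemma small_drop:
  assumes "small m b" "i < n"
  shows "small (m(i := 0)) (b + min (m i) 0)"
proof -
  have "\<bar>m i\<bar> \<le> real n * \<bar>m i\<bar>" using n_pos by (simp add: mult_le_cancel_right1)
  moreover have "real n * (\<Sum>j<n. \<bar>(m(i := 0)) j\<bar>) = real n * (\<Sum>j<n. \<bar>m j\<bar>) - real n * \<bar>m i\<bar>"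
    unfolding sum_fun_upd[OF assms(2), of abs m 0] by (simp add: algebra_simps)
  moreover have "\<bar>b + min (m i) 0\<bar> \<le> \<bar>b\<bar> + \<bar>m i\<bar>" by simp
  ultimately show ?thesis using assms(1) unfolding small_def by linarith
qed

lemma weighted_sum_le:
  assumes "small m b"
  shows "(\<Sum>i<n. weighted \<kappa> (m i) (x i)) \<le> delta (1 / 4) 1"
    and "r \<in> {0..1} \<Longrightarrow> delta r (\<Sum>i<n. weighted \<kappa> (m i) (x i))
      = (\<Sum>i<n. delta r (weighted \<kappa> (m i) (x i)))"
proof -
  have "0 \<le> \<kappa> \<and> weighted \<kappa> (m i) (x i) \<le> delta \<kappa> 1" if "i \<in> {..<n}" for i
    using that smallD[OF assms] kappa by (auto intro: weighted_le)
  note * = delta_sum[of "{..<n}" "\<lambda>_. \<kappa>" "\<lambda>i. weighted \<kappa> (m i) (x i)", OF finite_lessThan this]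
  from * show "(\<Sum>i<n. weighted \<kappa> (m i) (x i)) \<le> delta (1 / 4) 1"
    "r \<in> {0..1} \<Longrightarrow> delta r (\<Sum>i<n. weighted \<kappa> (m i) (x i))
      = (\<Sum>i<n. delta r (weighted \<kappa> (m i) (x i)))"
    using kappa(3) by simp_all
qed

lemma delta_affine_elt:
  assumes "small m b" "r \<in> {0..1}"
  shows "delta r (affine_elt m b) = (\<Sum>i<n. delta r (weighted \<kappa> (m i) (x i)))
    + delta r (delta (3 / 8 + b + (\<Sum>i<n. m i) / 2) 1)"
proof -
  have "(\<Sum>i<n. weighted \<kappa> (m i) (x i)) \<le> - delta (3 / 8 + b + (\<Sum>i<n. m i) / 2) 1"
    using weighted_sum_le(1)[OF assms(1)] smallD(2,3)[OF assms(1)]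
    by (intro bounded_disjoint[of _ "1 / 4" _ "3 / 8 + b + (\<Sum>i<n. m i) / 2"]) auto
  then show ?thesis
    using assms(2) weighted_sum_le(2)[OF assms] by (simp add: affine_elt_def delta_add)
qed

lemma affine_elt_convex:
  assumes "small m b" "small m' b'" "t \<in> {0..1}"
  shows "delta t (affine_elt m b) + delta (1 - t) (affine_elt m' b')
    = affine_elt (\<lambda>i. t * m i + (1 - t) * m' i) (t * b + (1 - t) * b')"
proof -
  let ?c = "3 / 8 + b + (\<Sum>i<n. m i) / 2" and ?c' = "3 / 8 + b' + (\<Sum>i<n. m' i) / 2"
  let ?w = "\<lambda>i. weighted \<kappa> (m i) (x i)" and ?w' = "\<lambda>i. weighted \<kappa> (m' i) (x i)"
  have t: "1 - t \<in> {0..1}" using assms(3) by simp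
  have c: "?c \<in> {0..1}" "?c' \<in> {0..1}"
    using smallD(2,3)[OF assms(1)] smallD(2,3)[OF assms(2)] by auto
  have "delta t (affine_elt m b) + delta (1 - t) (affine_elt m' b')
      = (\<Sum>i<n. delta t (?w i) + delta (1 - t) (?w' i)) + (delta t (delta ?c 1) + delta (1 - t) (delta ?c' 1))"
    unfolding delta_affine_elt[OF assms(1,3)] delta_affine_elt[OF assms(2) t]
    by (simp add: sum.distrib ac_simps)
  also have "(\<Sum>i<n. delta t (?w i) + delta (1 - t) (?w' i))
      = (\<Sum>i<n. weighted \<kappa> (t * m i + (1 - t) * m' i) (x i))"
    using assms smallD(1)[OF assms(1)] smallD(1)[OF assms(2)] kappa(2)
    by (intro sum.cong refl weighted_convex[symmetric]) auto
  also have "delta t (delta ?c 1) + delta (1 - t) (delta ?c' 1) = delta (t * ?c + (1 - t) * ?c') 1"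
    using assms(3) c by (rule delta_convex_left)
  also have "t * ?c + (1 - t) * ?c'
      = 3 / 8 + (t * b + (1 - t) * b') + (\<Sum>i<n. t * m i + (1 - t) * m' i) / 2"
    by (simp add: sum.distrib algebra_simps add_divide_distrib diff_divide_distrib sum_subtractf sum_distrib_left)
  finally show ?thesis by (simp add: affine_elt_def)
qed

text \<open>The summands are complementary in pairs: sizes \<open>\<kappa>\<close> for the
  generators total 1/4, and the two constants make up 3/4.\<close>

lemma uminus_affine_elt:
  assumes "small m b"
  shows "- affine_elt m b = affine_elt (\<lambda>i. - m i) (- b)"
proof (rule complementary_one)
  let ?s = "\<Sum>i<n. m i"
  have "complementary (\<Sum>i<n. \<kappa>) (\<Sum>i<n. weighted \<kappa> (m i) (x i)) (\<Sum>i<n. weighted \<kappa> (- m i) (x i))"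
    using smallD(1)[OF assms] kappa by (intro complementary_sum complementary_weighted) auto
  then have *: "complementary (1 / 4) (\<Sum>i<n. weighted \<kappa> (m i) (x i)) (\<Sum>i<n. weighted \<kappa> (- m i) (x i))"
    using kappa(3) by simp
  have "complementary (3 / 8 + b + ?s / 2 + (3 / 8 - b - ?s / 2))
      (delta (3 / 8 + b + ?s / 2) 1) (delta (3 / 8 - b - ?s / 2) 1)"
    using smallD(2,3)[OF assms] unfolding complementary_def
    by (auto simp: delta_add_left[symmetric] intro!: delta_disjoint)
  from complementary_add[OF * this]
  show "complementary 1 (affine_elt m b) (affine_elt (\<lambda>i. - m i) (- b))"
    by (simp add: affine_elt_def sum_negf)
qed

text \<open>A negative term is read as \<open>m i * x i = m i + (- m i) * (1 - x i)\<close>. In both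
  cases an element of the algebra is split off, so the rest lies below: the \<open>drop\<close>
  condition of \<open>farkas_cube\<close>.\<close>

lemma affine_elt_split:
  assumes "small m b" "i < n"
  shows "0 \<le> m i \<Longrightarrow> affine_elt m b = affine_elt (m(i := 0)) b + delta (m i) (x i)"
    and "m i \<le> 0 \<Longrightarrow> affine_elt m b = affine_elt (m(i := 0)) (b + m i) + delta (- m i) (- x i)"
proof -
  define R where "R = (\<Sum>j\<in>{..<n} - {i}. weighted \<kappa> (m j) (x j))"
  define s where "s = (\<Sum>j\<in>{..<n} - {i}. m j)"
  have A: "affine_elt (m(i := c)) d = R + (weighted \<kappa> c (x i) + delta (3 / 8 + d + (c + s) / 2) 1)" for c d
    using assms(2) by (simp add: affine_elt_def R_def s_def sum.remove[of _ i] ac_simps)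
  have A': "affine_elt m b = R + (weighted \<kappa> (m i) (x i) + delta (3 / 8 + b + (m i + s) / 2) 1)"
    using A[of "m i" b] by simp
  have k: "\<bar>m i\<bar> \<le> \<kappa>" "\<kappa> \<le> 1" using smallD(1)[OF assms] kappa by auto
  have "(\<Sum>j<n. m j) = m i + s" using assms(2) by (simp add: s_def sum.remove[of _ i])
  then have c: "1 / 8 \<le> 3 / 8 + b + (m i + s) / 2" "3 / 8 + b + (m i + s) / 2 \<le> 5 / 8"
    using smallD(2,3)[OF assms(1)] by simp_all
  have k': "\<kappa> \<le> 1 / 4" using n_pos by (simp add: \<kappa>_def)
  show "affine_elt m b = affine_elt (m(i := 0)) b + delta (m i) (x i)" if "0 \<le> m i"
  proof -
    have "weighted \<kappa> (m i) (x i) + delta ((3 / 8 + b + s / 2) + m i / 2) 1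
        = weighted \<kappa> 0 (x i) + delta (3 / 8 + b + s / 2) 1 + delta (m i) (x i)"
      using that k c k' by (intro weighted_shift) (auto simp: add_divide_distrib)
    then show ?thesis unfolding A' A by (simp only: add_0 add_divide_distrib) (simp only: ac_simps)
  qed
  show "affine_elt m b = affine_elt (m(i := 0)) (b + m i) + delta (- m i) (- x i)" if "m i \<le> 0"
  proof -
    have "weighted \<kappa> (- m i) (- x i) + delta ((3 / 8 + (b + m i) + s / 2) + - m i / 2) 1
        = weighted \<kappa> 0 (- x i) + delta (3 / 8 + (b + m i) + s / 2) 1 + delta (- m i) (- x i)"
      using that k c k' by (intro weighted_shift) (auto simp: add_divide_distrib)
    moreover have "(3 / 8 + (b + m i) + s / 2) + - m i / 2 = 3 / 8 + b + (m i + s) / 2"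
      by (simp add: field_simps)
    ultimately show ?thesis unfolding A' A weighted_uminus by (simp only: minus_minus minus_zero add_0 add.assoc)
  qed
qed

lemma affine_elt_drop:
  assumes "small m b" "i < n"
  shows "affine_elt (m(i := 0)) (b + min (m i) 0) \<le> affine_elt m b"
  using affine_elt_split[OF assms] by (cases "0 \<le> m i") (auto simp: le_iff_add min_def intro: exI[of _ 0])

lemma affine_elt_const:
  assumes "\<forall>i<n. m i = 0" "\<bar>b\<bar> \<le> 1 / 4"
  shows "affine_elt m b = delta (1 / 2 + b) 1"
proof -
  have k: "real k * (\<kappa> / 2) \<le> 1 / 8" if "k \<le> n" for k
  proof -
    have "real k * \<kappa> \<le> real n * \<kappa>" using that kappa by (intro mult_right_mono) auto
    then show ?thesis using kappa(3) by linarith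
  qed
  \<comment> \<open>Each summand is the constant \<open>\<kappa> / 2\<close>; all \<open>n\<close>
    of them give 1/8, which complements 3/8 to 1/2.\<close>
  have "(\<Sum>i<k. weighted \<kappa> (m i) (x i)) = delta (real k * (\<kappa> / 2)) 1" if "k \<le> n" for k
    using that
  proof (induction k)
    case (Suc k)
    have "delta (real (Suc k) * (\<kappa> / 2)) 1 = delta (real k * (\<kappa> / 2) + \<kappa> / 2) 1"
      by (simp add: algebra_simps add_divide_distrib)
    also have "\<dots> = delta (real k * (\<kappa> / 2)) 1 + delta (\<kappa> / 2) 1"
      using k[OF Suc.prems] kappa by (intro delta_add_left) (auto simp: algebra_simps)
    finally have "delta (real (Suc k) * (\<kappa> / 2)) (1 :: 'a) = delta (real k * (\<kappa> / 2)) 1 + delta (\<kappa> / 2) 1" .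
    moreover have "m k = 0" using Suc.prems assms(1) by simp
    ultimately show ?case using Suc.IH Suc.prems kappa(1,2)
      by (simp del: of_nat_Suc add: weighted_zero)
  qed simp
  from this[of n] have "(\<Sum>i<n. weighted \<kappa> (m i) (x i)) = delta (1 / 8) 1" using kappa(3) by simp
  moreover have "(\<Sum>i<n. m i) = 0" using assms(1) by simp
  ultimately have "affine_elt m b = delta (1 / 8) 1 + delta (3 / 8 + b) 1"
    unfolding affine_elt_def by simp
  also have "\<dots> = delta (1 / 8 + (3 / 8 + b)) 1"
    using assms(2) by (intro delta_add_left[symmetric]) auto
  finally show ?thesis by (simp add: add.assoc[symmetric])
qed

end

section \<open>Completeness for Riesz MV-algebras\<close>

primrec truth :: "(nat \<Rightarrow> real) \<Rightarrow> formula \<Rightarrow> real" where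
  "truth v (Var i) = v i"
| "truth v Zero = 0"
| "truth v One = 1"
| "truth v (\<phi> \<oplus> \<psi>) = min 1 (truth v \<phi> + truth v \<psi>)"
| "truth v (\<phi> \<odot> \<psi>) = max 0 (truth v \<phi> + truth v \<psi> - 1)"
| "truth v (Neg \<phi>) = 1 - truth v \<phi>"
| "truth v (Delta r \<phi>) = of_unit_real r * truth v \<phi>"

primrec interp :: "(nat \<Rightarrow> 'a::riesz_mv_algebra) \<Rightarrow> formula \<Rightarrow> 'a" where
  "interp x (Var i) = x i"
| "interp x Zero = 0"
| "interp x One = 1"
| "interp x (\<phi> \<oplus> \<psi>) = interp x \<phi> + interp x \<psi>"
| "interp x (\<phi> \<odot> \<psi>) = interp x \<phi> * interp x \<psi>"
| "interp x (Neg \<phi>) = - interp x \<phi>"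
| "interp x (Delta r \<phi>) = delta (of_unit_real r) (interp x \<phi>)"

primrec vars :: "formula \<Rightarrow> nat set" where
  "vars (Var i) = {i}"
| "vars Zero = {}"
| "vars One = {}"
| "vars (\<phi> \<oplus> \<psi>) = vars \<phi> \<union> vars \<psi>"
| "vars (\<phi> \<odot> \<psi>) = vars \<phi> \<union> vars \<psi>"
| "vars (Neg \<phi>) = vars \<phi>"
| "vars (Delta r \<phi>) = vars \<phi>"

lemma finite_vars: "finite (vars \<phi>)"
  by (induction \<phi>) auto

section \<open>Lattice normal forms of scaled formulae\<close>

context generated
begin

text \<open>A pair \<open>(a, g)\<close> consists of an element and the real function of the generators that it
  stands for, up to the shift by \<open>1 / 2\<close>.\<close>

inductive clause :: "'a \<Rightarrow> ((nat \<Rightarrow> real) \<Rightarrow> real) \<Rightarrow> bool" where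
  clause_affine: "small m b \<Longrightarrow> clause (affine_elt m b) (\<lambda>v. (\<Sum>i<n. m i * v i) + b)"
| clause_sup: "clause a g \<Longrightarrow> clause b h \<Longrightarrow> clause (sup a b) (\<lambda>v. max (g v) (h v))"

inductive cnf :: "'a \<Rightarrow> ((nat \<Rightarrow> real) \<Rightarrow> real) \<Rightarrow> bool" where
  cnf_clause: "clause a g \<Longrightarrow> cnf a g"
| cnf_inf: "cnf a g \<Longrightarrow> cnf b h \<Longrightarrow> cnf (inf a b) (\<lambda>v. min (g v) (h v))"

lemma cnf_affine: "small m b \<Longrightarrow> cnf (affine_elt m b) (\<lambda>v. (\<Sum>i<n. m i * v i) + b)"
  by (intro cnf_clause clause_affine)

text \<open>Distributivity holds for the lattice and for \<open>max\<close> and \<open>min\<close>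
  on the reals alike, which keeps element and function in step.\<close>

lemma cnf_sup:
  assumes "cnf a g" "cnf b h"
  shows "cnf (sup a b) (\<lambda>v. max (g v) (h v))"
  using assms(1)
proof induction
  case (cnf_clause a g)
  show ?case
    using assms(2)
  proof induction
    case (cnf_clause b h)
    then show ?case using \<open>clause a g\<close> by (intro cnf.cnf_clause clause_sup)
  next
    case (cnf_inf b h b' h')
    have "(\<lambda>v. max (g v) (min (h v) (h' v))) = (\<lambda>v. min (max (g v) (h v)) (max (g v) (h' v)))"
      by (simp add: max_min_distrib2)
    then show ?case using cnf.cnf_inf[OF cnf_inf.IH] by (simp add: sup_inf_distrib1)
  qed
next
  case (cnf_inf a g a' g')
  have "(\<lambda>v. max (min (g v) (g' v)) (h v)) = (\<lambda>v. min (max (g v) (h v)) (max (g' v) (h v)))"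
    by (simp add: max_min_distrib1)
  then show ?case using cnf.cnf_inf[OF cnf_inf.IH] by (simp add: sup_inf_distrib2)
qed

text \<open>De Morgan turns a clause into an infimum of affine elements and an infimum into a
  supremum, which \<open>cnf_sup\<close> brings back to normal form.\<close>

lemma cnf_uminus: "cnf a g \<Longrightarrow> cnf (- a) (\<lambda>v. - g v)"
proof (induction rule: cnf.induct)
  case (cnf_clause a g)
  then show ?case
  proof induction
    case (clause_affine m b)
    have "cnf (affine_elt (\<lambda>i. - m i) (- b)) (\<lambda>v. (\<Sum>i<n. - m i * v i) + - b)"
      using clause_affine by (intro cnf_affine) (simp add: small_uminus)
    then show ?case using clause_affine by (simp add: uminus_affine_elt sum_negf)
  next
    case (clause_sup a g b h)
    have "(\<lambda>v. - max (g v) (h v)) = (\<lambda>v. min (- g v) (- h v))" by (simp add: minus_max_eq_min)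
    then show ?case using cnf_inf[OF clause_sup.IH] by (simp add: uminus_sup)
  qed
next
  case (cnf_inf a g b h)
  have "(\<lambda>v. - min (g v) (h v)) = (\<lambda>v. max (- g v) (- h v))" by (simp add: minus_min_eq_max)
  then show ?case using cnf_sup[OF cnf_inf.IH] by (simp add: inf_uminus)
qed

text \<open>The arithmetic mean. It never overflows, so it stands in for addition on normal
  forms.\<close>

definition mid :: "'a \<Rightarrow> 'a \<Rightarrow> 'a" where
  "mid a b = delta (1 / 2) a + delta (1 / 2) b"

lemma mid_commute: "mid a b = mid b a"
  by (simp add: mid_def add.commute)

lemma mid_sup: "mid (sup a a') b = sup (mid a b) (mid a' b)"
proof -
  have "delta (1 / 2) c \<le> - delta (1 / 2) d" for c d :: 'a
    by (intro bounded_disjoint[of _ "1 / 2" _ "1 / 2"] delta_le) auto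
  then show ?thesis by (simp add: mid_def delta_sup add_sup_distrib)
qed

lemma mid_inf: "mid (inf a a') b = inf (mid a b) (mid a' b)"
  by (simp add: mid_commute[of _ b] mid_def[of b] delta_inf add_inf_distrib)

lemma half_max: "(max p q + r) / 2 = max ((p + r) / 2) ((q + r) / 2 :: real)"
  and half_min: "(min p q + r) / 2 = min ((p + r) / 2) ((q + r) / 2 :: real)"
  by (auto simp: max_def min_def)

text \<open>The mean distributes over \<open>sup\<close> and \<open>inf\<close> in each argument. On
  two affine elements it is the convex combination with weight 1/2.\<close>

lemma cnf_mid:
  assumes "cnf a g" "cnf b h"
  shows "cnf (mid a b) (\<lambda>v. (g v + h v) / 2)"
  using assms(1)
proof induction
  case (cnf_clause a g)
  then show ?case
  proof induction
    case (clause_affine m c)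
    \<comment> \<open>The arguments are swapped because \<open>mid_sup\<close> and
      \<open>mid_inf\<close> act on the first one.\<close>
    have "cnf (mid b (affine_elt m c)) (\<lambda>v. (h v + ((\<Sum>i<n. m i * v i) + c)) / 2)"
      using assms(2)
    proof induction
      case (cnf_clause b h)
      then show ?case
      proof induction
        case (clause_affine m' c')
        let ?m = "\<lambda>i. 1 / 2 * m' i + (1 - 1 / 2) * m i" and ?c = "1 / 2 * c' + (1 - 1 / 2) * c"
        have "mid (affine_elt m' c') (affine_elt m c) = affine_elt ?m ?c"
          using affine_elt_convex[OF clause_affine \<open>small m c\<close>, of "1 / 2"] by (simp add: mid_def)
        moreover have "small ?m ?c"
          using clause_affine \<open>small m c\<close> by (intro small_convex) auto
        moreover have "(\<Sum>i<n. ?m i * v i) + ?c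
            = ((\<Sum>i<n. m' i * v i) + c' + ((\<Sum>i<n. m i * v i) + c)) / 2" for v
          by (simp add: sum.distrib distrib_right add_divide_distrib sum_divide_distrib)
        ultimately show ?case using cnf_affine[of ?m ?c] by (simp only:)
      next
        case (clause_sup b h b' h')
        then show ?case using cnf_sup[OF clause_sup.IH] by (simp add: mid_sup half_max)
      qed
    next
      case (cnf_inf b h b' h')
      then show ?case using cnf.cnf_inf[OF cnf_inf.IH] by (simp add: mid_inf half_min)
    qed
    then show ?case by (simp add: mid_commute add.commute)
  next
    case (clause_sup a g a' g')
    then show ?case using cnf_sup[OF clause_sup.IH] by (simp add: mid_sup half_max)
  qed
next
  case (cnf_inf a g a' g')
  then show ?case using cnf.cnf_inf[OF cnf_inf.IH] by (simp add: mid_inf half_min)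
qed

text \<open>Flattens a clause into the finite set of its affine members, the shape that
  \<open>farkas_cube\<close> takes as \<open>F\<close>.\<close>

lemma clause_cover:
  assumes "clause a g"
  shows "\<exists>F. finite F \<and> (\<forall>(m, b) \<in> F. small m b \<and> affine_elt m b \<le> a) \<and>
    (\<forall>v. \<exists>(m, b) \<in> F. g v = (\<Sum>i<n. m i * v i) + b)"
  using assms
proof induction
  case (clause_affine m b)
  then show ?case by (intro exI[of _ "{(m, b)}"]) auto
next
  case (clause_sup a g b h)
  then obtain F G where
    F: "finite F" "\<forall>(m, c) \<in> F. small m c \<and> affine_elt m c \<le> a"
      "\<forall>v. \<exists>(m, c) \<in> F. g v = (\<Sum>i<n. m i * v i) + c" and
    G: "finite G" "\<forall>(m, c) \<in> G. small m c \<and> affine_elt m c \<le> b"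
      "\<forall>v. \<exists>(m, c) \<in> G. h v = (\<Sum>i<n. m i * v i) + c"
    by blast
  have "\<exists>(m, c) \<in> F \<union> G. max (g v) (h v) = (\<Sum>i<n. m i * v i) + c" for v
  proof (cases "g v \<le> h v")
    case True
    then have "max (g v) (h v) = h v" by simp
    then show ?thesis using G(3) by (simp only:) blast
  next
    case False
    then have "max (g v) (h v) = g v" by simp
    then show ?thesis using F(3) by (simp only:) blast
  qed
  moreover have "\<forall>(m, c) \<in> F \<union> G. small m c \<and> affine_elt m c \<le> sup a b"
    using F(2) G(2) by (auto intro: le_supI1 le_supI2)
  ultimately show ?case using F(1) G(1) by (intro exI[of _ "F \<union> G"]) simp
qed

text \<open>The passage from a pointwise bound to one in the algebra: the affine elements below
  \<open>a\<close> are closed under the operations of \<open>farkas_cube\<close>, which finds a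
  sufficiently large constant among them.\<close>

lemma clause_lower:
  assumes "clause a g" "\<bar>e\<bar> \<le> 1 / 4" "\<And>v. (\<And>i. 0 \<le> v i \<and> v i \<le> 1) \<Longrightarrow> e \<le> g v"
  shows "delta (1 / 2 + e) 1 \<le> a"
proof -
  obtain F where F: "finite F" "\<forall>(m, b) \<in> F. small m b \<and> affine_elt m b \<le> a"
      "\<forall>v. \<exists>(m, b) \<in> F. g v = (\<Sum>i<n. m i * v i) + b"
    using clause_cover[OF assms(1)] by blast
  \<comment> \<open>Forms are lowered by \<open>e\<close>, so that the bound \<open>e\<close>
    becomes nonnegativity. Convex combinations stay in \<open>C\<close> because
    \<open>delta t a + delta (1 - t) a = a\<close>.\<close>
  define C where "C = {(m, b). small m (b + e) \<and> affine_elt m (b + e) \<le> a}"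
  have "\<exists>(m, b) \<in> C. (\<forall>i<n. m i = 0) \<and> 0 \<le> b"
  proof (rule farkas_cube[where k = n and F = "(\<lambda>(m, b). (m, b - e)) ` F"])
    fix m b m' b' and t :: real assume *: "(m, b) \<in> C" "(m', b') \<in> C" "0 \<le> t" "t \<le> 1"
    let ?m = "\<lambda>i. t * m i + (1 - t) * m' i" and ?b = "t * (b + e) + (1 - t) * (b' + e)"
    have t: "t \<in> {0..1}" "1 - t \<in> {0..1}" using * by auto
    have s: "small m (b + e)" "small m' (b' + e)" "affine_elt m (b + e) \<le> a" "affine_elt m' (b' + e) \<le> a"
      using * by (auto simp: C_def)
    have "affine_elt ?m ?b = delta t (affine_elt m (b + e)) + delta (1 - t) (affine_elt m' (b' + e))"
      using affine_elt_convex[OF s(1,2) t(1)] by simp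
    also have "\<dots> \<le> delta t a + delta (1 - t) a"
      using s t by (intro add_mono delta_mono)
    also have "\<dots> = a"
      using t delta_add_left[of t "1 - t" a] by (simp add: delta_one_left)
    finally have "affine_elt ?m ?b \<le> a" .
    moreover have "small ?m ?b" using s t by (intro small_convex)
    moreover have "?b = t * b + (1 - t) * b' + e" by (simp add: algebra_simps)
    ultimately show "(?m, t * b + (1 - t) * b') \<in> C" by (simp add: C_def)
  next
    fix m b i assume "(m, b) \<in> C" "i < n"
    then show "(m(i := 0), b + min (m i) 0) \<in> C"
      using small_drop[of m "b + e" i] affine_elt_drop[of m "b + e" i]
      by (auto simp: C_def add.assoc add.commute[of e] intro: order.trans)
  next
    fix v :: "nat \<Rightarrow> real" assume "\<And>i. 0 \<le> v i \<and> v i \<le> 1"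
    then have "e \<le> g v" by (rule assms(3))
    moreover obtain m b where "(m, b) \<in> F" "g v = (\<Sum>i<n. m i * v i) + b" using F(3) by blast
    ultimately show "\<exists>(m, b)\<in>(\<lambda>(m, b). (m, b - e)) ` F. 0 \<le> (\<Sum>i<n. m i * v i) + b"
      by (intro bexI[of _ "(m, b - e)"]) (auto intro!: image_eqI[of _ _ "(m, b)"])
  qed (use F in \<open>auto simp: C_def\<close>)
  then obtain m b where mb: "small m (b + e)" "affine_elt m (b + e) \<le> a" "\<forall>i<n. m i = 0" "0 \<le> b"
    by (auto simp: C_def)
  have "delta (1 / 2 + e) 1 \<le> delta (1 / 2 + (b + e)) 1"
    using mb(4) assms(2) abs_le_D1[OF smallD(4)[OF mb(1)]] by (intro delta_mono_left) auto
  also have "\<dots> \<le> a" using mb smallD(4)[OF mb(1)] by (simp add: affine_elt_const)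
  finally show ?thesis .
qed

lemma cnf_lower:
  assumes "cnf a g" "\<bar>e\<bar> \<le> 1 / 4" "\<And>v. (\<And>i. 0 \<le> v i \<and> v i \<le> 1) \<Longrightarrow> e \<le> g v"
  shows "delta (1 / 2 + e) 1 \<le> a"
  using assms(1,3)
proof induction
  case (cnf_clause a g)
  then show ?case using clause_lower assms(2) by blast
next
  case (cnf_inf a g b h)
  then show ?case by (simp add: le_infI)
qed

text \<open>Scaling by a small \<open>\<epsilon>\<close> makes room for the truncation in \<open>\<oplus>\<close> to become a genuine
  minimum.\<close>

definition pl :: "'a \<Rightarrow> ((nat \<Rightarrow> real) \<Rightarrow> real) \<Rightarrow> bool" where
  "pl a g \<longleftrightarrow> (\<exists>\<epsilon>0>0. \<forall>\<epsilon>\<in>{0..\<epsilon>0}. cnf (delta (1 / 2) 1 + delta \<epsilon> a) (\<lambda>v. \<epsilon> * g v))"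

lemma plE:
  assumes "pl a g"
  obtains \<epsilon>0 where "0 < \<epsilon>0" "\<epsilon>0 \<le> 1 / 4"
    "\<And>\<epsilon>. 0 \<le> \<epsilon> \<Longrightarrow> \<epsilon> \<le> \<epsilon>0 \<Longrightarrow> cnf (delta (1 / 2) 1 + delta \<epsilon> a) (\<lambda>v. \<epsilon> * g v)"
proof -
  obtain \<epsilon>0 where "\<epsilon>0 > 0" "\<forall>\<epsilon>\<in>{0..\<epsilon>0}. cnf (delta (1 / 2) 1 + delta \<epsilon> a) (\<lambda>v. \<epsilon> * g v)"
    using assms by (auto simp: pl_def)
  then show ?thesis by (intro that[of "min \<epsilon>0 (1 / 4)"]) auto
qed

lemma small_zero: "\<bar>c\<bar> \<le> 1 / 4 \<Longrightarrow> small (\<lambda>_. 0) c"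
  by (simp add: small_def)

lemma cnf_const: "\<bar>c\<bar> \<le> 1 / 4 \<Longrightarrow> cnf (delta (1 / 2 + c) 1) (\<lambda>_. c)"
  using cnf_affine[OF small_zero, of c] affine_elt_const[of "\<lambda>_. 0" c] by simp

lemma pl_const: "pl 1 (\<lambda>_. 1)" "pl 0 (\<lambda>_. 0)"
proof -
  have "cnf (delta (1 / 2) 1 + delta \<epsilon> 1) (\<lambda>v. \<epsilon> * 1)" if "\<epsilon> \<in> {0..1 / 4}" for \<epsilon>
    using cnf_const[of \<epsilon>] that by (simp add: delta_add_left)
  then show "pl 1 (\<lambda>_. 1)" unfolding pl_def by (intro exI[of _ "1 / 4"]) auto
  have "cnf (delta (1 / 2) 1 + delta \<epsilon> 0) (\<lambda>v. \<epsilon> * 0)" if "\<epsilon> \<in> {0..1 / 4}" for \<epsilon>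
    using cnf_const[of 0] that by simp
  then show "pl 0 (\<lambda>_. 0)" unfolding pl_def by (intro exI[of _ "1 / 4"]) auto
qed

lemma pl_generator:
  assumes "i < n"
  shows "pl (x i) (\<lambda>v. v i)"
proof -
  have "cnf (delta (1 / 2) 1 + delta \<epsilon> (x i)) (\<lambda>v. \<epsilon> * v i)" if "\<epsilon> \<in> {0..\<kappa>}" for \<epsilon>
  proof -
    let ?m = "(\<lambda>_. 0)(i := \<epsilon>)"
    have "(\<Sum>j<n. \<bar>?m j\<bar>) = \<epsilon>"
      using sum_fun_upd[OF assms, of abs "\<lambda>_. 0" \<epsilon>] that by simp
    moreover have "real n * \<epsilon> \<le> real n * \<kappa>" using that by (intro mult_left_mono) auto
    ultimately have "small ?m 0" using kappa(3) by (simp add: small_def)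
    moreover have "affine_elt ?m 0 = delta (1 / 2) 1 + delta \<epsilon> (x i)"
      using affine_elt_split(1)[OF \<open>small ?m 0\<close> assms] that
      by (simp add: affine_elt_const fun_upd_idem)
    moreover have "(\<Sum>j<n. ?m j * v j) = \<epsilon> * v i" for v
      using assms by (simp add: sum.remove[of _ i])
    ultimately show ?thesis using cnf_affine[of ?m 0] by simp
  qed
  moreover have "0 < \<kappa>" using n_pos by (simp add: \<kappa>_def)
  ultimately show ?thesis by (auto simp: pl_def)
qed

text \<open>The mean halves both scales, hence the factor 2 in them; the two halves of the constant
  1/2 add up to 1/2 again.\<close>

lemma delta_half_shift:
  assumes "0 \<le> \<epsilon>" "\<epsilon> \<le> 1 / 8"
  shows "mid (delta (1 / 2) 1 + delta (2 * \<epsilon>) a) (delta (1 / 2) 1 + delta (2 * \<epsilon>) b)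
    = delta (1 / 2) 1 + (delta \<epsilon> a + delta \<epsilon> b)"
proof -
  have "delta (1 / 2) 1 \<le> - delta (2 * \<epsilon>) c" for c :: 'a
    using assms by (intro bounded_disjoint[of _ "1 / 2" _ "2 * \<epsilon>"] delta_le) auto
  then have "delta (1 / 2) (delta (1 / 2) 1 + delta (2 * \<epsilon>) c) = delta (1 / 4) 1 + delta \<epsilon> c" for c :: 'a
    using assms by (simp add: delta_add delta_delta)
  moreover have "delta (1 / 2) 1 = delta (1 / 4) 1 + delta (1 / 4) (1 :: 'a)"
    using delta_add_left[of "1 / 4" "1 / 4" "1 :: 'a"] by simp
  ultimately show ?thesis by (simp add: mid_def ac_simps)
qed

lemma pl_add:
  assumes "pl a g" "pl b h"
  shows "pl (a + b) (\<lambda>v. min 1 (g v + h v))"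
proof -
  obtain \<epsilon>1 where 1: "0 < \<epsilon>1" "\<epsilon>1 \<le> 1 / 4"
    "\<And>\<epsilon>. 0 \<le> \<epsilon> \<Longrightarrow> \<epsilon> \<le> \<epsilon>1 \<Longrightarrow> cnf (delta (1 / 2) 1 + delta \<epsilon> a) (\<lambda>v. \<epsilon> * g v)"
    using plE[OF assms(1)] by blast
  obtain \<epsilon>2 where 2: "0 < \<epsilon>2" "\<epsilon>2 \<le> 1 / 4"
    "\<And>\<epsilon>. 0 \<le> \<epsilon> \<Longrightarrow> \<epsilon> \<le> \<epsilon>2 \<Longrightarrow> cnf (delta (1 / 2) 1 + delta \<epsilon> b) (\<lambda>v. \<epsilon> * h v)"
    using plE[OF assms(2)] by blast
  have "cnf (delta (1 / 2) 1 + delta \<epsilon> (a + b)) (\<lambda>v. \<epsilon> * min 1 (g v + h v))"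
    if "\<epsilon> \<in> {0..min \<epsilon>1 \<epsilon>2 / 2}" for \<epsilon>
  proof -
    have e: "0 \<le> \<epsilon>" "\<epsilon> \<le> 1 / 8" "2 * \<epsilon> \<le> \<epsilon>1" "2 * \<epsilon> \<le> \<epsilon>2" using that 1 2 by auto
    \<comment> \<open>The infimum with the constant \<open>1 / 2 + \<epsilon>\<close> is the scaled
      truncation of \<open>a + b\<close> at 1.\<close>
    have "cnf (inf (delta (1 / 2 + \<epsilon>) 1)
        (mid (delta (1 / 2) 1 + delta (2 * \<epsilon>) a) (delta (1 / 2) 1 + delta (2 * \<epsilon>) b)))
        (\<lambda>v. min \<epsilon> ((2 * \<epsilon> * g v + 2 * \<epsilon> * h v) / 2))"
      using e 1 2 by (intro cnf_inf cnf_mid cnf_const) auto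
    moreover have "inf (delta (1 / 2 + \<epsilon>) 1)
        (mid (delta (1 / 2) 1 + delta (2 * \<epsilon>) a) (delta (1 / 2) 1 + delta (2 * \<epsilon>) b))
        = delta (1 / 2) 1 + delta \<epsilon> (a + b)"
      using e by (simp add: delta_half_shift delta_add_left delta_add_clip add_inf_distrib)
    moreover have "(\<lambda>v. min \<epsilon> ((2 * \<epsilon> * g v + 2 * \<epsilon> * h v) / 2)) = (\<lambda>v. \<epsilon> * min 1 (g v + h v))"
      using e by (simp add: min_mult_distrib_left distrib_left add_divide_distrib)
    ultimately show ?thesis by simp
  qed
  then show ?thesis unfolding pl_def using 1 2 by (intro exI[of _ "min \<epsilon>1 \<epsilon>2 / 2"]) auto
qed

text \<open>Negating \<open>1 / 2 + 2 \<epsilon> a\<close> gives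
  \<open>1 / 2 - 2 \<epsilon> a\<close>, whose mean with the constant
  \<open>1 / 2 + 2 \<epsilon>\<close> is \<open>1 / 2 + \<epsilon> (1 - a)\<close>.\<close>

lemma pl_uminus:
  assumes "pl a g"
  shows "pl (- a) (\<lambda>v. 1 - g v)"
proof -
  obtain \<epsilon>1 where 1: "0 < \<epsilon>1" "\<epsilon>1 \<le> 1 / 4"
    "\<And>\<epsilon>. 0 \<le> \<epsilon> \<Longrightarrow> \<epsilon> \<le> \<epsilon>1 \<Longrightarrow> cnf (delta (1 / 2) 1 + delta \<epsilon> a) (\<lambda>v. \<epsilon> * g v)"
    using plE[OF assms(1)] by blast
  have "cnf (delta (1 / 2) 1 + delta \<epsilon> (- a)) (\<lambda>v. \<epsilon> * (1 - g v))"
    if "\<epsilon> \<in> {0..\<epsilon>1 / 2}" for \<epsilon>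
  proof -
    have e: "0 \<le> \<epsilon>" "\<epsilon> \<le> 1 / 8" "2 * \<epsilon> \<le> \<epsilon>1" using that 1 by auto
    have "complementary ((1 / 2 + (1 / 2 - 2 * \<epsilon>)) + 2 * \<epsilon>)
       (delta (1 / 2) 1 + delta (2 * \<epsilon>) a) (delta (1 / 2 - 2 * \<epsilon>) 1 + delta (2 * \<epsilon>) (- a))"
      using e by (intro complementary_add complementary_delta)
        (auto simp: complementary_def delta_add_left[symmetric] intro: delta_disjoint)
    then have *: "- (delta (1 / 2) 1 + delta (2 * \<epsilon>) a) = delta (1 / 2 - 2 * \<epsilon>) 1 + delta (2 * \<epsilon>) (- a)"
      by (intro complementary_one) simp
    have "mid (delta (1 / 2 + 2 * \<epsilon>) 1) (- (delta (1 / 2) 1 + delta (2 * \<epsilon>) a))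
        = delta (1 / 4 + \<epsilon>) 1 + (delta (1 / 4 - \<epsilon>) 1 + delta \<epsilon> (- a))"
    proof -
      have "delta (1 / 2 - 2 * \<epsilon>) 1 \<le> - delta (2 * \<epsilon>) (- a)"
        using e by (intro bounded_disjoint[of _ "1 / 2 - 2 * \<epsilon>" _ "2 * \<epsilon>"] delta_le) auto
      then show ?thesis unfolding mid_def *
        using e by (simp add: delta_add delta_delta diff_divide_distrib distrib_left right_diff_distrib)
    qed
    also have "\<dots> = delta (1 / 2) 1 + delta \<epsilon> (- a)"
      using e delta_add_left[of "1 / 4 + \<epsilon>" "1 / 4 - \<epsilon>" "1 :: 'a"] by (simp add: add.assoc[symmetric])
    finally have "mid (delta (1 / 2 + 2 * \<epsilon>) 1) (- (delta (1 / 2) 1 + delta (2 * \<epsilon>) a))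
        = delta (1 / 2) 1 + delta \<epsilon> (- a)" .
    moreover have "cnf (mid (delta (1 / 2 + 2 * \<epsilon>) 1) (- (delta (1 / 2) 1 + delta (2 * \<epsilon>) a)))
        (\<lambda>v. (2 * \<epsilon> + - (2 * \<epsilon> * g v)) / 2)"
      using e 1 by (intro cnf_mid cnf_const cnf_uminus) auto
    moreover have "(\<lambda>v. (2 * \<epsilon> + - (2 * \<epsilon> * g v)) / 2) = (\<lambda>v. \<epsilon> * (1 - g v))"
      by (simp add: diff_divide_distrib right_diff_distrib)
    ultimately show ?thesis by simp
  qed
  then show ?thesis unfolding pl_def using 1 by (intro exI[of _ "\<epsilon>1 / 2"]) auto
qed

text \<open>The scalar is absorbed into the scale, which is possible because \<open>pl\<close>
  covers all scales up to its threshold.\<close>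

lemma pl_delta:
  assumes "pl a g" "r \<in> {0..1}"
  shows "pl (delta r a) (\<lambda>v. r * g v)"
proof -
  obtain \<epsilon>1 where 1: "0 < \<epsilon>1" "\<epsilon>1 \<le> 1 / 4"
    "\<And>\<epsilon>. 0 \<le> \<epsilon> \<Longrightarrow> \<epsilon> \<le> \<epsilon>1 \<Longrightarrow> cnf (delta (1 / 2) 1 + delta \<epsilon> a) (\<lambda>v. \<epsilon> * g v)"
    using plE[OF assms(1)] by blast
  have "cnf (delta (1 / 2) 1 + delta \<epsilon> (delta r a)) (\<lambda>v. \<epsilon> * (r * g v))" if "\<epsilon> \<in> {0..\<epsilon>1}" for \<epsilon>
  proof -
    have "\<epsilon> * r \<le> \<epsilon>" using that assms(2) by (simp add: mult_left_le)
    then have "0 \<le> \<epsilon> * r" "\<epsilon> * r \<le> \<epsilon>1" using that assms(2) by auto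
    then show ?thesis using 1(3)[of "\<epsilon> * r"] that assms(2) 1(2) by (simp add: delta_delta mult.assoc)
  qed
  then show ?thesis unfolding pl_def using 1 by (intro exI[of _ \<epsilon>1]) auto
qed

lemma pl_interp: "vars \<phi> \<subseteq> {..<n} \<Longrightarrow> pl (interp x \<phi>) (\<lambda>v. truth v \<phi>)"
proof (induction \<phi>)
  case (Odot \<phi> \<psi>)
  have "interp x \<phi> * interp x \<psi> = - (- interp x \<phi> + - interp x \<psi>)"
    by (simp add: uminus_add uminus_uminus)
  moreover have "(\<lambda>v. truth v (\<phi> \<odot> \<psi>)) = (\<lambda>v. 1 - min 1 ((1 - truth v \<phi>) + (1 - truth v \<psi>)))"
    by (auto simp: min_def max_def)
  ultimately show ?case
    using pl_uminus[OF pl_add[OF pl_uminus pl_uminus]] Odot by simp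
qed (use of_unit_real in \<open>auto intro: pl_generator pl_const pl_add pl_uminus pl_delta\<close>)

lemma pl_eq_one:
  assumes "pl a g" "\<And>v. (\<And>i. 0 \<le> v i \<and> v i \<le> 1) \<Longrightarrow> 1 \<le> g v"
  shows "a = 1"
proof -
  obtain \<epsilon> where e: "0 < \<epsilon>" "\<epsilon> \<le> 1 / 4" "cnf (delta (1 / 2) 1 + delta \<epsilon> a) (\<lambda>v. \<epsilon> * g v)"
  proof (rule plE[OF assms(1)])
    fix \<epsilon> :: real assume "0 < \<epsilon>" "\<epsilon> \<le> 1 / 4"
      "\<And>\<delta>. 0 \<le> \<delta> \<Longrightarrow> \<delta> \<le> \<epsilon> \<Longrightarrow> cnf (delta (1 / 2) 1 + delta \<delta> a) (\<lambda>v. \<delta> * g v)"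
    then show thesis by (intro that[of \<epsilon>]) auto
  qed
  have "delta (1 / 2 + \<epsilon>) 1 \<le> delta (1 / 2) 1 + delta \<epsilon> a"
    using e assms(2) by (intro cnf_lower[OF e(3)]) auto
  then have "delta \<epsilon> 1 + delta (1 / 2) 1 \<le> delta \<epsilon> a + delta (1 / 2) 1"
    using e by (simp add: delta_add_left add.commute)
  moreover have disj: "delta \<epsilon> c \<le> - delta (1 / 2) 1" for c :: 'a
    using e by (intro bounded_disjoint[of _ \<epsilon> _ "1 / 2"] delta_le) auto
  ultimately have "delta \<epsilon> 1 \<le> delta \<epsilon> a"
    using add_le_cancel[OF disj _ disj] by blast
  \<comment> \<open>An inequality of scaled elements says that a scaled difference vanishes, and
    \<open>delta_eq_zero\<close> removes the scale.\<close>
  then have "delta \<epsilon> (1 * - a) = 0"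
    using e delta_mult_uminus[of \<epsilon> 1 a] by (simp add: le_iff_mult)
  then have "- a = 0" using e delta_eq_zero[of \<epsilon> "- a"] by simp
  then show ?thesis by (metis uminus_uminus uminus_zero)
qed

end

theorem riesz_mv_completeness:
  assumes "\<And>v. (\<And>i. 0 \<le> v i \<and> v i \<le> 1) \<Longrightarrow> truth v \<phi> = truth v \<psi>"
  shows "interp x \<phi> = (interp x \<psi> :: 'a::riesz_mv_algebra)"
proof -
  have le: "interp x \<phi> \<le> interp x \<psi>"
    if *: "\<And>v. (\<And>i. 0 \<le> v i \<and> v i \<le> 1) \<Longrightarrow> truth v \<phi> = truth v \<psi>" for \<phi> \<psi>
  proof -
    let ?\<theta> = "Neg \<phi> \<oplus> \<psi>"
    obtain n where "\<forall>i \<in> vars ?\<theta>. i < n"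
      using finite_vars[of ?\<theta>] finite_nat_set_iff_bounded by blast
    \<comment> \<open>\<open>Suc n\<close> keeps the number of generators positive even for formulae
      without variables.\<close>
    then have n: "vars ?\<theta> \<subseteq> {..<Suc n}" by (auto intro: less_SucI)
    interpret generated "Suc n" x by unfold_locales simp
    have "1 \<le> truth v ?\<theta>" if "\<And>i. 0 \<le> v i \<and> v i \<le> 1" for v
      using *[OF that] by simp
    then have "interp x ?\<theta> = 1" by (rule pl_eq_one[OF pl_interp[OF n]])
    then show ?thesis by (simp add: less_eq_iff)
  qed
  show ?thesis using assms by (intro order.antisym le) auto
qed

section \<open>Formulae modulo derivability\<close>

lemma instantiates_sym:
  assumes "instantiates E \<phi> \<psi>"
  shows "instantiates E \<psi> \<phi>"
proof -
  obtain \<epsilon> \<epsilon>' s where "(\<epsilon>, \<epsilon>') \<in> E"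
    "(subst s \<epsilon> = \<phi> \<and> subst s \<epsilon>' = \<psi>) \<or> (subst s \<epsilon> = \<psi> \<and> subst s \<epsilon>' = \<phi>)"
    using assms unfolding instantiates_def by blast
  then have "\<exists>s. (subst s \<epsilon> = \<psi> \<and> subst s \<epsilon>' = \<phi>) \<or> (subst s \<epsilon> = \<phi> \<and> subst s \<epsilon>' = \<psi>)"
    by blast
  with \<open>(\<epsilon>, \<epsilon>') \<in> E\<close> show ?thesis
    unfolding instantiates_def by (intro bexI[of _ "(\<epsilon>, \<epsilon>')"]) simp_all
qed

lemma step_sym: "step E \<phi> \<psi> \<Longrightarrow> step E \<psi> \<phi>"
proof (induction rule: step.induct)
  case (1 \<gamma> \<gamma>')
  show ?case by (rule step.intros(1), rule instantiates_sym, rule 1)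
qed (rule step.intros(2-), assumption)+

lemma equivp_derivable: "equivp (derivable E)"
proof (rule equivpI)
  show "reflp (derivable E)" by (simp add: derivable_def reflpI)
  show "symp (derivable E)" unfolding derivable_def by (rule symp_rtranclp, rule sympI, rule step_sym)
  show "transp (derivable E)" unfolding derivable_def by (intro transpI) (rule rtranclp_trans)
qed

lemma derivable_cong1:
  assumes "derivable E \<phi> \<psi>" "\<And>\<phi> \<psi>. step E \<phi> \<psi> \<Longrightarrow> step E (f \<phi>) (f \<psi>)"
  shows "derivable E (f \<phi>) (f \<psi>)"
  using assms(1) unfolding derivable_def
  by induction (blast intro: rtranclp.rtrancl_into_rtrancl assms(2))+

lemma derivable_trans: "derivable E \<phi> \<psi> \<Longrightarrow> derivable E \<psi> \<chi> \<Longrightarrow> derivable E \<phi> \<chi>"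
  unfolding derivable_def by (rule rtranclp_trans)

lemma derivable_Oplus:
  assumes "derivable E \<phi> \<phi>'" "derivable E \<psi> \<psi>'"
  shows "derivable E (\<phi> \<oplus> \<psi>) (\<phi>' \<oplus> \<psi>')"
proof (rule derivable_trans)
  show "derivable E (\<phi> \<oplus> \<psi>) (\<phi>' \<oplus> \<psi>)"
    by (rule derivable_cong1[OF assms(1)], erule step.intros)
  show "derivable E (\<phi>' \<oplus> \<psi>) (\<phi>' \<oplus> \<psi>')"
    by (rule derivable_cong1[OF assms(2)], erule step.intros)
qed

lemma derivable_Odot:
  assumes "derivable E \<phi> \<phi>'" "derivable E \<psi> \<psi>'"
  shows "derivable E (\<phi> \<odot> \<psi>) (\<phi>' \<odot> \<psi>')"
proof (rule derivable_trans)
  show "derivable E (\<phi> \<odot> \<psi>) (\<phi>' \<odot> \<psi>)"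
    by (rule derivable_cong1[OF assms(1)], erule step.intros)
  show "derivable E (\<phi>' \<odot> \<psi>) (\<phi>' \<odot> \<psi>')"
    by (rule derivable_cong1[OF assms(2)], erule step.intros)
qed

lemma derivable_Neg: "derivable E \<phi> \<psi> \<Longrightarrow> derivable E (Neg \<phi>) (Neg \<psi>)"
  by (erule derivable_cong1) (rule step.intros)

lemma derivable_Delta: "derivable E \<phi> \<psi> \<Longrightarrow> derivable E (Delta r \<phi>) (Delta r \<psi>)"
  by (erule derivable_cong1) (rule step.intros)

lemma derivable_axiom:
  assumes "(\<epsilon>, \<epsilon>') \<in> E"
  shows "derivable E (subst s \<epsilon>) (subst s \<epsilon>')"
  using assms unfolding derivable_def
  by (intro r_into_rtranclp step.intros(1)) (auto simp: instantiates_def)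

\<comment> \<open>The Lindenbaum algebra: equality of classes is derivability, so the completeness
  theorem for algebras applied here yields derivations.\<close>
quotient_type lindenbaum = formula / "derivable RMV"
  by (rule equivp_derivable)

instantiation lindenbaum :: riesz_mv_algebra
begin

lift_definition zero_lindenbaum :: lindenbaum is Zero .
lift_definition one_lindenbaum :: lindenbaum is One .
lift_definition plus_lindenbaum :: "lindenbaum \<Rightarrow> lindenbaum \<Rightarrow> lindenbaum" is Oplus
  by (rule derivable_Oplus)
lift_definition times_lindenbaum :: "lindenbaum \<Rightarrow> lindenbaum \<Rightarrow> lindenbaum" is Odot
  by (rule derivable_Odot)
lift_definition uminus_lindenbaum :: "lindenbaum \<Rightarrow> lindenbaum" is Neg
  by (rule derivable_Neg)
lift_definition delta_lindenbaum :: "real \<Rightarrow> lindenbaum \<Rightarrow> lindenbaum" is \<Delta>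
  by (rule derivable_Delta)

definition less_eq_lindenbaum :: "lindenbaum \<Rightarrow> lindenbaum \<Rightarrow> bool" where
  "less_eq_lindenbaum a b \<longleftrightarrow> - a + b = 1"
definition less_lindenbaum :: "lindenbaum \<Rightarrow> lindenbaum \<Rightarrow> bool" where
  "less_lindenbaum a b \<longleftrightarrow> a \<le> b \<and> \<not> b \<le> a"
definition inf_lindenbaum :: "lindenbaum \<Rightarrow> lindenbaum \<Rightarrow> lindenbaum" where
  "inf_lindenbaum a b = (a + - b) * b"
definition sup_lindenbaum :: "lindenbaum \<Rightarrow> lindenbaum \<Rightarrow> lindenbaum" where
  "sup_lindenbaum a b = a * - b + b"

instance
proof
  \<comment> \<open>Assigns formulae to the axiom variables 0, 1 and 2; axioms with fewer variables
    repeat an entry.\<close>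
  let ?s = "\<lambda>x y z i :: nat. if i = 0 then x else if i = 1 then y else (z :: formula)"
  note defs = RMV_def MV_def Let_def
  fix a b c :: lindenbaum and r q :: real
  show "a + b + c = a + (b + c)"
  proof (transfer, goal_cases)
    case (1 x y z)
    show ?case
      using equivp_symp[OF equivp_derivable derivable_axiom[of "Var 0 \<oplus> (Var 1 \<oplus> Var 2)"
        "(Var 0 \<oplus> Var 1) \<oplus> Var 2" RMV "?s x y z"]]
      by (simp add: defs)
  qed
  show "a * b * c = a * (b * c)"
  proof (transfer, goal_cases)
    case (1 x y z)
    show ?case
      using equivp_symp[OF equivp_derivable derivable_axiom[of "Var 0 \<odot> (Var 1 \<odot> Var 2)"
        "(Var 0 \<odot> Var 1) \<odot> Var 2" RMV "?s x y z"]]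
      by (simp add: defs)
  qed
  have add_comm: "a + b = b + a" for a b :: lindenbaum
  proof (transfer, goal_cases)
    case (1 x y)
    show ?case
      using derivable_axiom[of "Var 0 \<oplus> Var 1" "Var 1 \<oplus> Var 0" RMV "?s x y y"] by (simp add: defs)
  qed
  have mult_comm: "a * b = b * a" for a b :: lindenbaum
  proof (transfer, goal_cases)
    case (1 x y)
    show ?case
      using derivable_axiom[of "Var 0 \<odot> Var 1" "Var 1 \<odot> Var 0" RMV "?s x y y"] by (simp add: defs)
  qed
  have zero: "a + 0 = a" for a :: lindenbaum
  proof (transfer, goal_cases)
    case (1 x)
    show ?case using derivable_axiom[of "Var 0 \<oplus> Zero" "Var 0" RMV "?s x x x"] by (simp add: defs)
  qed
  show "0 + a = a"
    using zero[of a] add_comm by metis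
  show "a + b = b + a" by (rule add_comm)
  have one: "a * 1 = a" for a :: lindenbaum
  proof (transfer, goal_cases)
    case (1 x)
    show ?case using derivable_axiom[of "Var 0 \<odot> One" "Var 0" RMV "?s x x x"] by (simp add: defs)
  qed
  show "1 * a = a"
    using one[of a] mult_comm by metis
  show "a * b = b * a" by (rule mult_comm)
  show "a + - a = 1"
  proof (transfer, goal_cases)
    case (1 x)
    show ?case using derivable_axiom[of "Var 0 \<oplus> Neg (Var 0)" One RMV "?s x x x"] by (simp add: defs)
  qed
  show "a + 1 = 1"
  proof (transfer, goal_cases)
    case (1 x)
    show ?case using derivable_axiom[of "Var 0 \<oplus> One" One RMV "?s x x x"] by (simp add: defs)
  qed
  show "a * 0 = 0"
  proof (transfer, goal_cases)
    case (1 x)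
    show ?case using derivable_axiom[of "Var 0 \<odot> Zero" Zero RMV "?s x x x"] by (simp add: defs)
  qed
  show "- (a + b) = - a * - b"
  proof (transfer, goal_cases)
    case (1 x y)
    show ?case
      using derivable_axiom[of "Neg (Var 0 \<oplus> Var 1)" "Neg (Var 0) \<odot> Neg (Var 1)" RMV "?s x y y"]
      by (simp add: defs)
  qed
  show "- (- a) = a"
  proof (transfer, goal_cases)
    case (1 x)
    show ?case
      using equivp_symp[OF equivp_derivable derivable_axiom[of "Var 0" "Neg (Neg (Var 0))" RMV "?s x x x"]]
      by (simp add: defs)
  qed
  show "- 0 = (1 :: lindenbaum)"
  proof transfer
    show "derivable RMV (Neg Zero) One"
      using derivable_axiom[of "Neg Zero" One RMV Var] by (simp add: defs)
  qed
  show "a * - b + b = b * - a + a"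
  proof (transfer, goal_cases)
    case (1 x y)
    show ?case
      using derivable_axiom[of "(Var 0 \<odot> Neg (Var 1)) \<oplus> Var 1" "(Var 1 \<odot> Neg (Var 0)) \<oplus> Var 0"
          RMV "?s x y y"]
      by (simp add: defs)
  qed
  show "delta r (a * - b) = delta r a * - delta r b" if "r \<in> {0..1}"
    using that
  proof (transfer, goal_cases)
    case (1 r x y)
    then have "(\<Delta> r (Var 0 \<odot> Neg (Var 1)), \<Delta> r (Var 0) \<odot> Neg (\<Delta> r (Var 1))) \<in> RMV"
      unfolding RMV_def Let_def by blast
    from derivable_axiom[OF this, of "?s x y y"] show ?case by simp
  qed
  show "delta (max 0 (r - q)) a = delta r a * - delta q a" if "r \<in> {0..1}" "q \<in> {0..1}"
    using that
  proof (transfer, goal_cases)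
    case (1 r q x)
    then have "(\<Delta> (max 0 (r - q)) (Var 0), \<Delta> r (Var 0) \<odot> Neg (\<Delta> q (Var 0))) \<in> RMV"
      unfolding RMV_def Let_def by blast
    from derivable_axiom[OF this, of "?s x x x"] show ?case by simp
  qed
  show "delta r (delta q a) = delta (r * q) a" if "r \<in> {0..1}" "q \<in> {0..1}"
    using that
  proof (transfer, goal_cases)
    case (1 r q x)
    then have "(\<Delta> r (\<Delta> q (Var 0)), \<Delta> (r * q) (Var 0)) \<in> RMV"
      unfolding RMV_def Let_def by blast
    from derivable_axiom[OF this, of "?s x x x"] show ?case by simp
  qed
  show "delta 1 a = a"
  proof (transfer, goal_cases)
    case (1 x)
    have "(\<Delta> 1 (Var 0), Var 0) \<in> RMV" unfolding RMV_def Let_def by blast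
    from derivable_axiom[OF this, of "?s x x x"] show ?case by simp
  qed
qed (fact less_eq_lindenbaum_def less_lindenbaum_def inf_lindenbaum_def sup_lindenbaum_def)+

end

text \<open>Under the canonical valuation, interpretation is the quotient map.\<close>

lemma interp_lindenbaum: "interp (\<lambda>i. abs_lindenbaum (Var i)) \<phi> = abs_lindenbaum \<phi>"
  by (induction \<phi>)
    (simp_all add: zero_lindenbaum_def one_lindenbaum_def plus_lindenbaum.abs_eq
      times_lindenbaum.abs_eq uminus_lindenbaum.abs_eq delta_lindenbaum.abs_eq of_unit_real_inverse)

theorem RMV_complete:
  assumes "\<And>v. (\<And>i. 0 \<le> v i \<and> v i \<le> 1) \<Longrightarrow> truth v \<phi> = truth v \<psi>"
  shows "derivable RMV \<phi> \<psi>"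
  using riesz_mv_completeness[OF assms, of "\<lambda>i. abs_lindenbaum (Var i)"]
  by (simp add: interp_lindenbaum lindenbaum.abs_eq_iff)

section \<open>Soundness of the extraction\<close>

definition clip :: "real \<Rightarrow> real" where
  "clip t = max (min t 1) 0"

lemma truth_bounds:
  assumes "\<And>i. 0 \<le> v i \<and> v i \<le> 1"
  shows "0 \<le> truth v \<phi> \<and> truth v \<phi> \<le> 1"
proof (induction \<phi>)
  case (Delta r \<phi>)
  then show ?case using of_unit_real[of r] by (auto intro: mult_nonneg_nonneg mult_le_one)
qed (use assms in auto)

text \<open>If \<open>\<phi>\<close> is \<open>Zero\<close>, the simplified formula carries no
  truncation; the bound on \<open>truth v \<psi>\<close> makes up for it.\<close>

lemma truth_oplus_simp: "truth v \<psi> \<le> 1 \<Longrightarrow> truth v (oplus_simp \<phi> \<psi>) = min 1 (truth v \<phi> + truth v \<psi>)"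
  by (simp add: oplus_simp_def)

lemma truth_odot_simp: "0 \<le> truth v \<phi> \<Longrightarrow> truth v (odot_simp \<phi> \<psi>) = max 0 (truth v \<phi> + truth v \<psi> - 1)"
  by (simp add: odot_simp_def)

lemma affine_update:
  assumes "k < length m"
  shows "affine (m[k := c]) b x = affine m b x - m ! k * x ! k + c * x ! k"
  using assms by (simp add: affine_def sum.remove[of _ k])

lemma affine_uminus: "affine (map uminus m) (1 - b) x = 1 - affine m b x"
  by (simp add: affine_def sum_negf)

lemma affine_shift: "affine m (b + c) x = affine m b x + c"
  by (simp add: affine_def)

text \<open>The identity behind the recursion of \<open>extr\<close>, with \<open>f\<close> the affine function and \<open>y\<close>
  the part of it that is split off.\<close>

lemma clip_split:
  assumes "0 \<le> y" "y \<le> 1"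
  shows "max 0 (min 1 (clip (f - y) + y) + clip (f - y + 1) - 1) = clip f"
  using assms by (auto simp: clip_def min_def max_def)

lemma clip_nonneg: "0 \<le> clip t"
  by (simp add: clip_def)

text \<open>Induction along the recursion of \<open>extr\<close>: \<open>clip_split\<close> settles
  the positive leading coefficients, and \<open>clip (1 - t) = 1 - clip t\<close> the negative
  ones.\<close>

lemma truth_extr:
  assumes "\<And>i. 0 \<le> v i \<and> v i \<le> 1"
  shows "truth v (extr m b) = clip (affine m b (map v [0..<length m]))"
proof (induction m b rule: extr.induct)
  case (1 m b)
  let ?x = "map v [0..<length m]" and ?k = "first_nonzero m"
  have x: "?x \<in> cube (length m)" using assms by (auto simp: cube_def)
  note bounds = affine_min_attained(2)[OF x, of b] affine_max_attained(2)[OF x, of b]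
  show ?case
  proof (cases "affine_min m b \<ge> 1 \<or> affine_max m b \<le> 0")
    case True
    then show ?thesis using bounds by (subst extr.simps) (auto simp: clip_def)
  next
    case ncst: False
    show ?thesis
    proof (cases "\<forall>i < length m. m ! i = 0")
      case True
      then have "affine m b y = b" for y by (simp add: affine_def)
      \<comment> \<open>The attained minimum and maximum are both \<open>b\<close>, which the failed
        first tests place strictly between 0 and 1.\<close>
      moreover from this have "b \<in> {0..1}" using ncst affine_min_attained(1)[of m b]
          affine_max_attained(1)[of m b] by auto
      ultimately show ?thesis
        using ncst True by (subst extr.simps) (auto simp: clip_def to_unit_real_inverse)
    next
      case nz: False
      have k: "?k < length m" "m ! ?k \<noteq> 0" using first_nonzero[OF nz] by auto
      have xk: "?x ! ?k = v ?k" using k by simp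
      let ?f = "affine m b ?x"
      consider "1 \<le> m ! ?k" | "0 < m ! ?k" "m ! ?k < 1" | "m ! ?k < 0"
        using k(2) by linarith
      then show ?thesis
      proof cases
        case A: 1
        let ?m = "m[?k := m ! ?k - 1]"
        have "affine ?m b ?x = ?f - v ?k"
          using affine_update[OF k(1), of "m ! ?k - 1" b ?x] xk by (simp add: algebra_simps)
        then have "truth v (extr ?m b) = clip (?f - v ?k)" "truth v (extr ?m (b + 1)) = clip (?f - v ?k + 1)"
          using "1.IH"(1,2) ncst nz A by (simp_all add: affine_shift)
        then show ?thesis
          using ncst A assms[of ?k] clip_nonneg
          by (subst extr.simps) (simp add: nz Let_def truth_odot_simp truth_oplus_simp clip_split)
      next
        case A: 2
        let ?m = "m[?k := 0]" and ?y = "m ! ?k * v ?k"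
        have y: "0 \<le> ?y" "?y \<le> 1" using A assms[of ?k] by (auto intro: mult_le_one)
        have "affine ?m b ?x = ?f - ?y"
          using affine_update[OF k(1), of 0 b ?x] xk by simp
        then have "truth v (extr ?m b) = clip (?f - ?y)" "truth v (extr ?m (b + 1)) = clip (?f - ?y + 1)"
          using "1.IH"(3,4) ncst nz A by (simp_all add: affine_shift)
        then show ?thesis
          using ncst A y clip_nonneg
          by (subst extr.simps)
            (simp add: nz Let_def truth_odot_simp truth_oplus_simp clip_split to_unit_real_inverse)
      next
        case A: 3
        then have "truth v (extr (map uminus m) (1 - b)) = clip (1 - ?f)"
          using "1.IH"(5) ncst nz by (simp add: affine_uminus)
        then show ?thesis
          using ncst A by (subst extr.simps) (simp add: nz Let_def, auto simp: clip_def)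
      qed
    qed
  qed
qed

section \<open>Substitution graphs and the splitting of nodes\<close>

lemma truth_subst: "truth v (subst s \<phi>) = truth (\<lambda>i. truth v (s i)) \<phi>"
  by (induction \<phi>) auto

lemma represented_Cons: "G \<noteq> [] \<Longrightarrow> represented (lev # G) = subst_level lev (represented G)"
  by (simp add: represented_def)

lemma affine_Cons: "affine (a # m) b (y # ys) = a * y + affine m b ys"
  by (simp add: affine_def sum.lessThan_Suc_shift del: sum.lessThan_Suc)

lemma affine_replicate: "affine (replicate (length z) a @ m) b (z @ y) = a * sum_list z + affine m b y"
  by (induction z) (simp_all add: affine_Cons distrib_left)

text \<open>Repeating a weight for all copies of a parent amounts to applying it once to the sum of
  their values.\<close>

lemma affine_rewire:
  assumes "length (weights v) = length zs"
  shows "affine (weights (rewire (map length zs) v)) b (concat zs) = affine (weights v) b (map sum_list zs)"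
proof -
  have "length m = length zs \<Longrightarrow>
      affine (concat (map2 replicate (map length zs) m)) b (concat zs) = affine m b (map sum_list zs)" for m
  proof (induction zs arbitrary: m)
    case (Cons z zs)
    then show ?case by (cases m) (simp_all add: affine_replicate affine_Cons)
  qed simp
  then show ?thesis using assms by (simp add: rewire_def)
qed

lemma length_rewire:
  "length (weights v) = length cs \<Longrightarrow> length (weights (rewire cs v)) = sum_list cs"
proof -
  have "length m = length cs \<Longrightarrow> length (concat (map2 replicate cs m)) = sum_list cs" for m :: "real list"
  proof (induction cs arbitrary: m)
    case (Cons c cs)
    then show ?case by (cases m) simp_all
  qed simp
  then show "length (weights v) = length cs \<Longrightarrow> ?thesis" by (simp add: rewire_def)
qed

text \<open>The summand \<open>clip (t - real k)\<close> is the portion of \<open>t\<close> between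
  \<open>k\<close> and \<open>k + 1\<close>.\<close>

lemma sum_clip: "(\<Sum>k<c. clip (t - real k)) = min (relu t) (real c)"
  by (induction c) (auto simp: clip_def relu_def min_def max_def)

lemma affine_le_max_preact:
  assumes "x \<in> cube (length (weights v))"
  shows "affine (weights v) (bias v) x \<le> max_preact v"
  using affine_max_attained(2)[OF assms, of "bias v"]
  by (simp add: affine_max_attained(3) max_preact_def sum_list_sum_nth atLeast0LessThan)

text \<open>The number of copies is at least the largest preactivation on the cube, so the sum of
  the clipped pieces is not cut off.\<close>

lemma sum_split_node:
  assumes "x \<in> cube (length (weights v))"
  shows "(\<Sum>u\<leftarrow>split_node v. clip (affine (weights u) (bias u) x)) = relu (affine (weights v) (bias v) x)"
proof -
  let ?t = "affine (weights v) (bias v) x"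
  have "(\<Sum>u\<leftarrow>split_node v. clip (affine (weights u) (bias u) x)) = (\<Sum>k<copies v. clip (?t - real k))"
    using affine_shift[of "weights v" "bias v" "- real k" x for k]
    by (simp add: split_node_def o_def interv_sum_list_conv_sum_set_nat atLeast0LessThan)
  also have "\<dots> = min (relu ?t) (real (copies v))" by (rule sum_clip)
  also have "relu ?t \<le> real (copies v)"
    using affine_le_max_preact[OF assms] le_of_int_ceiling[of "max_preact v"]
    by (auto simp: copies_def relu_def intro: order.trans)
  then have "min (relu ?t) (real (copies v)) = relu ?t" by simp
  finally show ?thesis .
qed

text \<open>Recurses over the list of levels in the pattern of \<open>convert\<close>, so that one
  induction serves both.\<close>

fun relu_output :: "neuron list list \<Rightarrow> real list \<Rightarrow> real" where
  "relu_output [] y = 0"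
| "relu_output [out] y = affine (weights (hd out)) (bias (hd out)) y"
| "relu_output (lev # lev' # levs) y =
     relu_output (lev' # levs) (map (\<lambda>v. relu (affine (weights v) (bias v) y)) lev)"

fun chained :: "nat \<Rightarrow> neuron list list \<Rightarrow> bool" where
  "chained k [] \<longleftrightarrow> False"
| "chained k [out] \<longleftrightarrow> length out = 1 \<and> length (weights (hd out)) = k"
| "chained k (lev # lev' # levs) \<longleftrightarrow>
     (\<forall>v \<in> set lev. length (weights v) = k) \<and> chained (length lev) (lev' # levs)"

abbreviation extr_level :: "neuron list \<Rightarrow> formula list" where
  "extr_level \<equiv> map (\<lambda>v. extr (weights v) (bias v))"

lemma convert_not_Nil: "levs \<noteq> [] \<Longrightarrow> convert cs levs \<noteq> []"
  by (cases "(cs, levs)" rule: convert.cases) (auto simp: Let_def)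

text \<open>\<open>zs\<close> groups the values of the clipped nodes by the ReLU node that they come from.\<close>

lemma truth_convert:
  assumes "\<And>i. 0 \<le> v i \<and> v i \<le> 1"
    and "map v [0..<length (concat zs)] = concat zs" "chained (length zs) levs"
  shows "truth v (represented (map extr_level (convert (map length zs) levs)))
    = clip (relu_output levs (map sum_list zs))"
  using assms
proof (induction levs "map sum_list zs" arbitrary: v zs rule: relu_output.induct)
  case (2 out)
  then obtain u where out: "out = [u]" by (auto simp: length_Suc_conv)
  have "length (weights (rewire (map length zs) u)) = length (concat zs)"
    using 2 out by (simp add: length_rewire length_concat)
  then have "truth v (extr (weights (rewire (map length zs) u)) (bias u)) =
      clip (affine (weights (rewire (map length zs) u)) (bias u) (concat zs))"
    using 2 truth_extr[of v] by simp
  also have "\<dots> = clip (affine (weights u) (bias u) (map sum_list zs))"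
    using 2 out affine_rewire[of u zs] by simp
  finally show ?case using out by (simp add: represented_def rewire_def)
next
  case (3 lev lev' levs)
  let ?z = "concat zs" and ?vs = "map (rewire (map length zs)) lev"
  let ?val = "\<lambda>u. clip (affine (weights u) (bias u) ?z)"
  \<comment> \<open>The clipped values of the nodes split from one ReLU node form a group; by
    \<open>sum_split_node\<close> its sum is the ReLU value.\<close>
  define zs' where "zs' = map (\<lambda>u. map ?val (split_node u)) ?vs"
  define G where "G = extr_level (concat (map split_node ?vs))"
  \<comment> \<open>By \<open>truth_subst\<close>, evaluating under \<open>v\<close> after
    substituting this level is evaluating the remaining levels under \<open>w\<close>.\<close>
  define w where "w = (\<lambda>i. truth v (if i < length G then G ! i else Var i))"
  have len: "length (weights u) = length ?z" if "u \<in> set ?vs" for u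
    using that 3(4) by (auto simp: length_rewire length_concat)
  have z: "?z \<in> cube (length ?z)"
  proof -
    have "set ?z = v ` {0..<length ?z}" using arg_cong[OF 3(3), of set] by simp
    then show ?thesis unfolding cube_def using 3(2) by auto
  qed
  have val: "truth v (extr (weights u) (bias u)) = ?val u" if "u \<in> set (concat (map split_node ?vs))" for u
  proof -
    have "length (weights u) = length ?z" using that len by (auto simp: split_node_def)
    then show ?thesis using truth_extr[of v "weights u" "bias u"] 3(2,3) by simp
  qed
  have G: "length G = length (concat zs')" "map (truth v) G = concat zs'"
  proof -
    have "concat zs' = map ?val (concat (map split_node ?vs))"
      by (simp add: zs'_def map_concat o_def)
    then show "map (truth v) G = concat zs'" using val by (simp add: G_def)
    then have "length (map (truth v) G) = length (concat zs')" by (rule arg_cong)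
    then show "length G = length (concat zs')" by (simp only: length_map)
  qed
  have sums: "map sum_list zs' = map (\<lambda>u. relu (affine (weights u) (bias u) (map sum_list zs))) lev"
  proof -
    have "sum_list (map ?val (split_node (rewire (map length zs) u)))
        = relu (affine (weights u) (bias u) (map sum_list zs))" if "u \<in> set lev" for u
    proof -
      have "sum_list (map ?val (split_node (rewire (map length zs) u)))
          = relu (affine (weights (rewire (map length zs) u)) (bias u) ?z)"
        using sum_split_node[of ?z "rewire (map length zs) u"] z len[of "rewire (map length zs) u"] that
        by simp (simp add: rewire_def)
      then show ?thesis using affine_rewire[of u zs] that 3(4) by simp
    qed
    then show ?thesis by (simp add: zs'_def)
  qed
  have lens: "map length zs' = map copies ?vs"
    by (simp add: zs'_def split_node_def)
  have "truth w (represented (map extr_level (convert (map length zs') (lev' # levs))))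
      = clip (relu_output (lev' # levs) (map sum_list zs'))"
  proof (rule 3(1))
    show "map (\<lambda>u. relu (affine (weights u) (bias u) (map sum_list zs))) lev = map sum_list zs'"
      using sums by simp
    show "0 \<le> w i \<and> w i \<le> 1" for i
      unfolding w_def using 3(2) by (intro truth_bounds)
    show "map w [0..<length (concat zs')] = concat zs'"
      unfolding G(2)[symmetric] G(1)[symmetric] by (intro nth_equalityI) (auto simp: w_def)
    show "chained (length zs') (lev' # levs)" using 3(4) by (simp add: zs'_def)
  qed
  moreover have "represented (map extr_level (convert (map length zs) (lev # lev' # levs)))
      = subst_level G (represented (map extr_level (convert (map length zs') (lev' # levs))))"
    unfolding lens convert.simps(3) Let_def list.map(2) G_def
    by (intro represented_Cons) (simp add: convert_not_Nil)
  ultimately show ?case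
    using sums by (simp add: subst_level_def truth_subst w_def del: convert.simps)
qed simp

section \<open>From indexed networks to lists of levels\<close>

lemma chained_drop:
  assumes "wf_network N" "j < depth N"
  shows "chained (width N j) (drop j (levels N))"
proof -
  have "j \<le> depth N - 1" using assms(2) by simp
  then show ?thesis
  \<comment> \<open>Induction backwards from the output level, since \<open>chained\<close> at
    \<open>j\<close> unfolds to \<open>chained\<close> at \<open>Suc j\<close>.\<close>
  proof (induction rule: inc_induct)
    case base
    have d: "1 \<le> depth N" "width N (depth N) = 1" using assms(1) by (auto simp: wf_network_def)
    have "drop (depth N - 1) (levels N) = [levels N ! (depth N - 1)]"
      using d Cons_nth_drop_Suc[of "depth N - 1" "levels N"] by (simp add: depth_def)
    moreover have "length (levels N ! (depth N - 1)) = 1" using d by (simp add: width_def)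
    moreover from this have "length (weights (hd (levels N ! (depth N - 1)))) = width N (depth N - 1)"
      using assms(1) d unfolding wf_network_def node_def
      by (metis One_nat_def atLeastAtMost_iff hd_conv_nth le_refl length_0_conv less_one zero_neq_one)
    ultimately show ?case by simp
  next
    case (step j)
    then have j: "Suc j < depth N" by simp
    have *: "drop j (levels N) = levels N ! j # drop (Suc j) (levels N)"
      using j by (simp add: Cons_nth_drop_Suc depth_def)
    have "drop (Suc j) (levels N) \<noteq> []" using j by (simp add: depth_def)
    then obtain l ls where ls: "drop (Suc j) (levels N) = l # ls" by (cases "drop (Suc j) (levels N)") auto
    have "\<forall>i<width N (Suc j). length (weights (node N (Suc j) i)) = width N j"
      using assms(1) j by (auto simp: wf_network_def)
    then have "\<forall>v \<in> set (levels N ! j). length (weights v) = width N j"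
      by (auto simp: in_set_conv_nth node_def width_def)
    moreover have "width N (Suc j) = length (levels N ! j)" by (simp add: width_def)
    ultimately show ?case using step.IH unfolding * ls by simp
  qed
qed

lemma global_maps_Suc_hidden:
  assumes "Suc j < depth N"
  shows "global_maps N (Suc j) x
    = map (\<lambda>v. relu (affine (weights v) (bias v) (global_maps N j x))) (levels N ! j)"
  using assms by (intro nth_equalityI) (auto simp: local_map_def width_def node_def)

text \<open>Invariant: feeding the values of level \<open>j\<close> to the remaining levels gives
  the same output for every \<open>j\<close>. At the last \<open>j\<close> only the output node is
  left, which has no activation.\<close>

lemma realization_eq_relu_output:
  assumes "wf_network N" "length x = inputs N"
  shows "realization N x = relu_output (levels N) x"
proof -
  have d: "1 \<le> depth N" "width N (depth N) = 1" using assms(1) by (auto simp: wf_network_def)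
  have "relu_output (levels N) x = relu_output (drop j (levels N)) (global_maps N j x)"
    if "j < depth N" for j
    using that
  proof (induction j)
    case 0
    have "global_maps N 0 x = x"
      using assms(2) by (intro nth_equalityI) (auto simp: local_map_def width_def)
    then show ?case by simp
  next
    case (Suc j)
    have *: "drop j (levels N) = levels N ! j # drop (Suc j) (levels N)"
      using Suc.prems by (simp add: Cons_nth_drop_Suc depth_def)
    have "drop (Suc j) (levels N) \<noteq> []" using Suc.prems by (simp add: depth_def)
    then obtain l ls where ls: "drop (Suc j) (levels N) = l # ls" by (cases "drop (Suc j) (levels N)") auto
    show ?case
      using Suc unfolding global_maps_Suc_hidden[OF Suc.prems] ls by (simp add: * ls del: drop_Suc)
  qed
  from this[of "depth N - 1"]
  have "relu_output (levels N) x = relu_output (drop (depth N - 1) (levels N)) (global_maps N (depth N - 1) x)"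
    using d by simp
  also have "drop (depth N - 1) (levels N) = [levels N ! (depth N - 1)]"
    using d Cons_nth_drop_Suc[of "depth N - 1" "levels N"] by (simp add: depth_def)
  also have "relu_output [levels N ! (depth N - 1)] (global_maps N (depth N - 1) x) = realization N x"
  proof -
    obtain k where k: "depth N = Suc k" using d by (cases "depth N") auto
    have "length (levels N ! k) = 1" using d k by (simp add: width_def)
    then have "hd (levels N ! k) = levels N ! k ! 0" by (intro hd_conv_nth) auto
    then show ?thesis
      using d by (simp add: realization_def global_map_def k local_map_def node_def)
  qed
  finally show ?thesis by simp
qed

lemma truth_represented_ext:
  assumes "wf_network N" "\<And>i. 0 \<le> v i \<and> v i \<le> 1"
  shows "truth v (represented (ext N)) = clip (realization N (map v [0..<inputs N]))"
proof -
  \<comment> \<open>Input nodes are not split, so every group of values is a singleton.\<close>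
  let ?n = "inputs N" and ?zs = "map (\<lambda>i. [v i]) [0..<inputs N]"
  let ?G = "map extr_level (convert (replicate ?n 1) (levels N))"
  have "levels N \<noteq> []" using assms(1) by (auto simp: wf_network_def depth_def)
  then have "represented (ext N) = subst_level (map Var [0..<?n]) (represented ?G)"
    unfolding ext_def to_sigma_def by (simp add: represented_Cons convert_not_Nil)
  then have "truth v (represented (ext N)) = truth (\<lambda>i. truth v (if i < ?n then map Var [0..<?n] ! i else Var i)) (represented ?G)"
    by (simp add: subst_level_def truth_subst)
  also have "(\<lambda>i. truth v (if i < ?n then map Var [0..<?n] ! i else Var i)) = v"
    by (auto simp: fun_eq_iff)
  also have "truth v (represented ?G) = clip (relu_output (levels N) (map sum_list ?zs))"
  proof -
    have "concat ?zs = map v [0..<?n]" by (induction "inputs N") auto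
    moreover have "map length ?zs = replicate ?n 1" by (simp add: map_replicate_const o_def)
    moreover have "chained ?n (levels N)"
      using chained_drop[OF assms(1), of 0] assms(1) by (simp add: wf_network_def width_def)
    ultimately show ?thesis using truth_convert[of v ?zs "levels N"] assms(2) by simp
  qed
  also have "map sum_list ?zs = map v [0..<?n]" by simp
  finally show ?thesis using realization_eq_relu_output[OF assms(1)] by simp
qed

theorem theorem10:
  fixes n :: nat and N1 N2 :: network
  assumes "N1 \<in> nondegenerate_networks n" and "N2 \<in> nondegenerate_networks n"
    and "\<forall>x \<in> cube n. realization N1 x = realization N2 x"
  shows "network_derivable RMV N1 N2"
proof -
  have N: "wf_network N1" "inputs N1 = n" "wf_network N2" "inputs N2 = n"
    using assms(1,2) by (auto simp: nondegenerate_networks_def)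
  \<comment> \<open>Both sides are clipped realizations at the point of the cube given by
    \<open>v\<close>, where the two networks agree.\<close>
  have "truth v (represented (ext N1)) = truth v (represented (ext N2))"
    if v: "\<And>i. 0 \<le> v i \<and> v i \<le> 1" for v
  proof -
    have "map v [0..<n] \<in> cube n" using v by (auto simp: cube_def)
    then have "realization N1 (map v [0..<n]) = realization N2 (map v [0..<n])"
      using assms(3) by blast
    then show ?thesis
      using truth_represented_ext[OF N(1) v] truth_represented_ext[OF N(3) v] N(2,4) by simp
  qed
  then show ?thesis unfolding network_derivable_def by (rule RMV_complete)
qed

end
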